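(* Let $M$ be a closed (compact, without boundary) smooth manifold of dimension $n$ with a volume form $\Omega$, and let $\varepsilon \geq 0$. If $F_1,\dots,F_n \in C^\infty(M)$ satisfy $$\|\{F_1,\dots,F_n\}\|_{L^1} \leq 2\varepsilon,$$ then there exist $F_1',\dots,F_n' \in C^\infty(M)$ such that $\|F_i-F_i'\| \leq \varepsilon^{1/n}$ for every $i=1,\dots,n$ and $\{F_1',\dots,F_n'\} \equiv 0$ on $M$.
   Context: $C^\infty(M)$ denotes the real-valued smooth functions on $M$. For an $n$-dimensional manifold $M$ with a volume form $\Omega$ and $F_1,\dots,F_n \in C^\infty(M)$, the bracket $\{F_1,\dots,F_n\}\in C^\infty(M)$ is the function defined by $\{F_1,\dots,F_n\}\,\Omega = dF_1\wedge\dots\wedge dF_n$. For a real function $F$ on a set $X$, $\|F\| = \sup_{x\in X}|F(x)|$ is the uniform norm. For a compactly supported continuous function $F$ on $M$, $\|F\|_{L^1} = \int_M |F|\,\Omega$ (with $M$ oriented by $\Omega$). *)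

theory Defs
  imports "HOL-Analysis.Analysis"
begin

section \<open>Smooth maps between open subsets of Euclidean spaces\<close>

primrec Ck_on ::
  "nat \<Rightarrow> 'a::euclidean_space set \<Rightarrow> ('a \<Rightarrow> 'b::real_normed_vector) \<Rightarrow> bool" where
  "Ck_on 0 S f \<longleftrightarrow> continuous_on S f"
| "Ck_on (Suc k) S f \<longleftrightarrow>
     (\<forall>x\<in>S. f differentiable (at x)) \<and>
     (\<forall>u. Ck_on k S (\<lambda>x. frechet_derivative f (at x) u))"

text \<open>Only meant for open sets: differentiability is with respect to the full neighbourhood filter.\<close>

definition smooth_on ::
  "'a::euclidean_space set \<Rightarrow> ('a \<Rightarrow> 'b::real_normed_vector) \<Rightarrow> bool" where
  "smooth_on S f \<longleftrightarrow> (\<forall>k. Ck_on k S f)"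


section \<open>Smooth manifolds\<close>

text \<open>
  A chart is a domain together with a coordinate map; the values of the map outside the domain are
  irrelevant.  The dimension of the manifold is the cardinality of the index type.
\<close>

type_synonym ('a, 'n) chart = "'a set \<times> ('a \<Rightarrow> real ^ 'n)"

abbreviation chart_dom :: "('a, 'n::finite) chart \<Rightarrow> 'a set" where
  "chart_dom c \<equiv> fst c"

abbreviation chart_map :: "('a, 'n::finite) chart \<Rightarrow> 'a \<Rightarrow> real ^ 'n" where
  "chart_map c \<equiv> snd c"

abbreviation chart_codom :: "('a, 'n::finite) chart \<Rightarrow> (real ^ 'n) set" where
  "chart_codom c \<equiv> chart_map c ` chart_dom c"

abbreviation chart_inv :: "('a, 'n::finite) chart \<Rightarrow> real ^ 'n \<Rightarrow> 'a" where
  "chart_inv c \<equiv> inv_into (chart_dom c) (chart_map c)"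

definition is_chart :: "'a::t2_space set \<Rightarrow> ('a, 'n::finite) chart \<Rightarrow> bool" where
  "is_chart M c \<longleftrightarrow>
     openin (top_of_set M) (chart_dom c) \<and> open (chart_codom c) \<and>
     homeomorphism (chart_dom c) (chart_codom c) (chart_map c) (chart_inv c)"

definition smoothly_compatible ::
  "('a, 'n::finite) chart \<Rightarrow> ('a, 'n) chart \<Rightarrow> bool" where
  "smoothly_compatible c d \<longleftrightarrow>
     smooth_on (chart_map c ` (chart_dom c \<inter> chart_dom d)) (chart_map d \<circ> chart_inv c) \<and>
     smooth_on (chart_map d ` (chart_dom c \<inter> chart_dom d)) (chart_map c \<circ> chart_inv d)"

text \<open>A smooth structure is a maximal smooth atlas.\<close>

definition smooth_structure ::
  "'a::t2_space set \<Rightarrow> ('a, 'n::finite) chart set \<Rightarrow> bool" where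
  "smooth_structure M A \<longleftrightarrow>
     (\<forall>c\<in>A. is_chart M c) \<and> (\<Union>c\<in>A. chart_dom c) = M \<and>
     (\<forall>c\<in>A. \<forall>d\<in>A. smoothly_compatible c d) \<and>
     (\<forall>c. is_chart M c \<and> (\<forall>d\<in>A. smoothly_compatible c d) \<longrightarrow> c \<in> A)"

text \<open>
  The manifold carries the subspace topology of an arbitrary Hausdorff space (possibly the whole
  space).  It has no boundary since charts map onto open sets.
\<close>

definition smooth_manifold ::
  "'a::t2_space set \<Rightarrow> ('a, 'n::finite) chart set \<Rightarrow> bool" where
  "smooth_manifold M A \<longleftrightarrow>
     second_countable (top_of_set M) \<and> smooth_structure M A"

definition closed_manifold ::
  "'a::t2_space set \<Rightarrow> ('a, 'n::finite) chart set \<Rightarrow> bool" where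
  "closed_manifold M A \<longleftrightarrow> smooth_manifold M A \<and> compact M"

text \<open>Membership does not depend on the values of the function outside the manifold.\<close>

definition smooth_functions :: "('a, 'n::finite) chart set \<Rightarrow> ('a \<Rightarrow> real) set" where
  "smooth_functions A = {F. \<forall>c\<in>A. smooth_on (chart_codom c) (F \<circ> chart_inv c)}"


section \<open>Tangent vectors and differential forms\<close>

text \<open>
  Tangent vectors at \<open>p\<close> are represented as the directional derivative operators
  \<open>F \<mapsto> D(F \<circ> \<phi>\<^sup>-\<^sup>1)(\<phi> p) u\<close> on smooth functions; they are extended by \<open>0\<close> to non-smooth
  functions so that equal derivations are equal as HOL functions.
\<close>

type_synonym 'a tangent = "('a \<Rightarrow> real) \<Rightarrow> real"

definition chart_tangent ::
  "('a, 'n::finite) chart set \<Rightarrow> ('a, 'n) chart \<Rightarrow> 'a \<Rightarrow> real ^ 'n \<Rightarrow> 'a tangent" where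
  "chart_tangent A c p u =
     (\<lambda>F. if F \<in> smooth_functions A
          then frechet_derivative (F \<circ> chart_inv c) (at (chart_map c p)) u else 0)"

definition tangent_space :: "('a, 'n::finite) chart set \<Rightarrow> 'a \<Rightarrow> 'a tangent set" where
  "tangent_space A p = {chart_tangent A c p u | c u. c \<in> A \<and> p \<in> chart_dom c}"

definition coord_frame ::
  "('a, 'n::finite) chart set \<Rightarrow> ('a, 'n) chart \<Rightarrow> 'a \<Rightarrow> 'n \<Rightarrow> 'a tangent" where
  "coord_frame A c p = (\<lambda>i. chart_tangent A c p (axis i 1))"

definition differential :: "('a \<Rightarrow> real) \<Rightarrow> 'a tangent \<Rightarrow> real" where
  "differential F v = v F"

text \<open>Forms of top degree take a family of tangent vectors indexed by \<open>'n\<close>.\<close>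

type_synonym ('a, 'n) top_form = "'a \<Rightarrow> ('n \<Rightarrow> 'a tangent) \<Rightarrow> real"

definition alternating_multilinear ::
  "'a tangent set \<Rightarrow> (('n \<Rightarrow> 'a tangent) \<Rightarrow> real) \<Rightarrow> bool" where
  "alternating_multilinear V \<omega> \<longleftrightarrow>
     (\<forall>v i a b u w. (\<forall>j. v j \<in> V) \<and> u \<in> V \<and> w \<in> V \<longrightarrow>
        \<omega> (v(i := (\<lambda>F. a * u F + b * w F))) = a * \<omega> (v(i := u)) + b * \<omega> (v(i := w))) \<and>
     (\<forall>v i j. (\<forall>k. v k \<in> V) \<and> i \<noteq> j \<and> v i = v j \<longrightarrow> \<omega> v = 0)"

definition smooth_top_form ::
  "'a set \<Rightarrow> ('a, 'n::finite) chart set \<Rightarrow> ('a, 'n) top_form \<Rightarrow> bool" where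
  "smooth_top_form M A \<omega> \<longleftrightarrow>
     (\<forall>p\<in>M. alternating_multilinear (tangent_space A p) (\<omega> p)) \<and>
     (\<forall>c\<in>A. smooth_on (chart_codom c)
        (\<lambda>x. \<omega> (chart_inv c x) (coord_frame A c (chart_inv c x))))"

definition volume_form ::
  "'a set \<Rightarrow> ('a, 'n::finite) chart set \<Rightarrow> ('a, 'n) top_form \<Rightarrow> bool" where
  "volume_form M A \<Omega> \<longleftrightarrow>
     smooth_top_form M A \<Omega> \<and>
     (\<forall>p\<in>M. \<exists>v. (\<forall>i. v i \<in> tangent_space A p) \<and> \<Omega> p v \<noteq> 0)"

text \<open>
  The wedge product of a family of covectors.  No order on the index type is needed, as covectors
  and arguments share it and a simultaneous reordering leaves the determinant unchanged.
\<close>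

definition wedge :: "('n::finite \<Rightarrow> 'a tangent \<Rightarrow> real) \<Rightarrow> ('n \<Rightarrow> 'a tangent) \<Rightarrow> real" where
  "wedge \<alpha> v = det (\<chi> i j. \<alpha> i (v j))"

text \<open>
  The function determined by \<open>bracket \<cdot> \<Omega> = dF\<^sub>1 \<and> \<dots> \<and> dF\<^sub>n\<close>: on each tangent space of the
  manifold there is exactly one such scalar, because top-degree forms are a line spanned by \<open>\<Omega>\<close>.
\<close>

definition bracket ::
  "('a, 'n::finite) chart set \<Rightarrow> ('a, 'n) top_form \<Rightarrow> ('n \<Rightarrow> 'a \<Rightarrow> real) \<Rightarrow> 'a \<Rightarrow> real" where
  "bracket A \<Omega> F p =
     (THE r. \<forall>v. (\<forall>i. v i \<in> tangent_space A p) \<longrightarrow>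
        r * \<Omega> p v = wedge (\<lambda>i. differential (F i)) v)"


section \<open>Integration and norms\<close>

definition oriented_chart ::
  "('a, 'n::finite) chart set \<Rightarrow> ('a, 'n) top_form \<Rightarrow> ('a, 'n) chart \<Rightarrow> bool" where
  "oriented_chart A \<Omega> c \<longleftrightarrow>
     c \<in> A \<and> (\<forall>p\<in>chart_dom c. \<Omega> p (coord_frame A c p) > 0)"

text \<open>
  A finite smooth partition of unity on a compact manifold, subordinate to the domains of charts
  that are positively oriented by \<open>\<Omega>\<close>.
\<close>

definition oriented_partition ::
  "'a::t2_space set \<Rightarrow> ('a, 'n::finite) chart set \<Rightarrow> ('a, 'n) top_form \<Rightarrow>
   ('a, 'n) chart set \<Rightarrow> (('a, 'n) chart \<Rightarrow> 'a \<Rightarrow> real) \<Rightarrow> bool" where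
  "oriented_partition M A \<Omega> C \<rho> \<longleftrightarrow>
     finite C \<and>
     (\<forall>c\<in>C. oriented_chart A \<Omega> c \<and> \<rho> c \<in> smooth_functions A \<and> (\<forall>p\<in>M. 0 \<le> \<rho> c p) \<and>
        (\<exists>K. compact K \<and> K \<subseteq> chart_dom c \<and> (\<forall>p\<in>M - K. \<rho> c p = 0))) \<and>
     (\<forall>p\<in>M. (\<Sum>c\<in>C. \<rho> c p) = 1)"

text \<open>
  The integral of a continuous top-degree form \<open>\<omega>\<close> over a closed manifold oriented by \<open>\<Omega>\<close>.
  A partition as above exists and the value does not depend on it, so \<open>SOME\<close> below picks
  the only candidate.
\<close>

definition has_form_integral ::
  "'a::t2_space set \<Rightarrow> ('a, 'n::finite) chart set \<Rightarrow> ('a, 'n) top_form \<Rightarrow>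
   ('a, 'n) top_form \<Rightarrow> real \<Rightarrow> bool" where
  "has_form_integral M A \<Omega> \<omega> I \<longleftrightarrow>
     (\<exists>C \<rho>. oriented_partition M A \<Omega> C \<rho> \<and>
        I = (\<Sum>c\<in>C. integral (chart_codom c)
               (\<lambda>x. \<rho> c (chart_inv c x) *
                    \<omega> (chart_inv c x) (coord_frame A c (chart_inv c x)))))"

definition form_integral ::
  "'a::t2_space set \<Rightarrow> ('a, 'n::finite) chart set \<Rightarrow> ('a, 'n) top_form \<Rightarrow>
   ('a, 'n) top_form \<Rightarrow> real" where
  "form_integral M A \<Omega> \<omega> = (SOME I. has_form_integral M A \<Omega> \<omega> I)"

definition L1_norm ::
  "'a::t2_space set \<Rightarrow> ('a, 'n::finite) chart set \<Rightarrow> ('a, 'n) top_form \<Rightarrow> ('a \<Rightarrow> real) \<Rightarrow> real"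
  where "L1_norm M A \<Omega> F = form_integral M A \<Omega> (\<lambda>p v. \<bar>F p\<bar> * \<Omega> p v)"

text \<open>Extended values make this meaningful for unbounded functions and for the empty set.\<close>

definition uniform_norm :: "'a set \<Rightarrow> ('a \<Rightarrow> real) \<Rightarrow> ennreal" where
  "uniform_norm X F = (SUP x\<in>X. ennreal \<bar>F x\<bar>)"

end

theory Submission
  imports Defs
begin

text \<open>
  Let \<open>f = (F\<^sub>1, \<dots>, F\<^sub>n) : M \<rightarrow> \<real>\<^sup>n\<close>.  In charts the integrand of the \<open>L\<^sup>1\<close> norm is \<open>\<bar>det Df\<bar>\<close>, so
  the compact set \<open>f(M)\<close> has volume at most \<open>2\<epsilon>\<close>.  If \<open>n \<ge> 2\<close> and \<open>\<epsilon> > 0\<close>, put \<open>r = \<epsilon>\<^sup>1\<^sup>/\<^sup>n\<close>;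
  a lattice of mesh \<open>\<delta> = 3r/2\<close> has cells of volume larger than \<open>2\<epsilon>\<close>, hence by averaging some
  translate of it avoids \<open>f(M)\<close>, and by compactness every point of \<open>f(M)\<close> has a coordinate staying
  away from the translate of \<open>\<delta>\<int>\<close>.  Composing each \<open>F\<^sub>i\<close> with a smooth staircase that jumps only
  close to these points moves it by about \<open>\<delta>/2 < r\<close> and makes, near every point of \<open>M\<close>, one of the
  functions locally constant.  If \<open>n = 1\<close>, the oscillation of \<open>F\<close> on each component of \<open>M\<close> is at
  most \<open>2\<epsilon>\<close>, and \<open>F\<close> is replaced by the midpoint of its range there.  If \<open>\<epsilon> = 0\<close>, the bracket
  already vanishes.
\<close>

section \<open>Calculus of smooth maps\<close>

text \<open>In a chart the bracket is the Jacobian determinant divided by a nonvanishing density, so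
  one function that is constant near a point already makes it vanish there. This is why each
  \<open>F i\<close> may be perturbed separately: a point is settled as soon as one coordinate is
  good, and missing the lattice says exactly that the coordinates are never all bad at once.

  The mesh is squeezed from two sides. Cells larger than 2\<epsilon> require (\<delta>/r)^n > 2, and
  the displacement bound \<delta>(1/2 + s) \<le> r with s > 0 requires \<delta>/r < 2. Such a ratio
  exists only for n \<ge> 2, where 3/2 always works because (3/2)^2 > 2. For n = 1 connectedness
  takes over: an interval of values has its length as measure.

  The volume bound meets the obstacle that the norm weighs charts by a partition of unity, whereas
  images are taken of sets. Cutting M into pieces on which all weights are nearly constant converts
  weights into sets at an arbitrarily small loss.\<close>

lemma Ck_on_subset: "Ck_on k S f \<Longrightarrow> T \<subseteq> S \<Longrightarrow> Ck_on k T f"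
  by (induction k arbitrary: f) (auto intro: continuous_on_subset)

lemma frechet_derivative_cong_open:
  assumes "open S" "x \<in> S" "\<And>y. y \<in> S \<Longrightarrow> f y = g y"
  shows "frechet_derivative f (at x) = frechet_derivative g (at x)"
proof -
  have "(f has_derivative D) (at x) \<longleftrightarrow> (g has_derivative D) (at x)" for D
    using assms by (metis has_derivative_transform_within_open)
  then show ?thesis
    by (simp add: frechet_derivative_def)
qed

lemma differentiable_cong_open:
  assumes "open S" "x \<in> S" "\<And>y. y \<in> S \<Longrightarrow> f y = g y"
  shows "f differentiable (at x) \<longleftrightarrow> g differentiable (at x)"
  using assms unfolding differentiable_def by (metis has_derivative_transform_within_open)

lemma Ck_on_cong:
  assumes "open S" "\<And>x. x \<in> S \<Longrightarrow> f x = g x"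
  shows "Ck_on k S f \<longleftrightarrow> Ck_on k S g"
  using assms(2)
proof (induction k arbitrary: f g)
  case 0
  then show ?case by (simp cong: continuous_on_cong)
next
  case (Suc k)
  have "Ck_on k S (\<lambda>x. frechet_derivative f (at x) u) \<longleftrightarrow> Ck_on k S (\<lambda>x. frechet_derivative g (at x) u)" for u
    using Suc frechet_derivative_cong_open[OF assms(1), of _ f g] by (intro Suc.IH) auto
  moreover have "f differentiable (at x) \<longleftrightarrow> g differentiable (at x)" if "x \<in> S" for x
    using differentiable_cong_open[OF assms(1) that, of f g] Suc.prems by auto
  ultimately show ?case by auto
qed

text \<open>Lets a function be checked with a different formula near each point, as for bump
  functions extended by zero, the staircase, and locally constant functions.\<close>

lemma Ck_on_local:
  assumes "\<And>x. x \<in> S \<Longrightarrow> \<exists>U. open U \<and> x \<in> U \<and> Ck_on k U f"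
  shows "Ck_on k S f"
  using assms
proof (induction k arbitrary: f)
  case 0
  then show ?case
    by (metis Ck_on.simps(1) continuous_at_imp_continuous_on continuous_on_eq_continuous_at)
next
  case (Suc k)
  have "Ck_on k S (\<lambda>x. frechet_derivative f (at x) u)" for u
    by (rule Suc.IH) (use Suc.prems in force)
  moreover have "f differentiable (at x)" if "x \<in> S" for x
    using Suc.prems[OF that] by auto
  ultimately show ?case by auto
qed

lemma Ck_on_SucD: "Ck_on (Suc k) S f \<Longrightarrow> Ck_on k S f"
proof (induction k arbitrary: f)
  case 0
  then show ?case
    by (simp add: continuous_at_imp_continuous_on differentiable_imp_continuous_within)
next
  case (Suc k)
  then show ?case by simp
qed

lemma Ck_on_const: "Ck_on k S (\<lambda>x. c)"
  by (induction k arbitrary: c) (auto simp: frechet_derivative_const)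

lemma frechet_derivative_eqI:
  "(f has_derivative f') (at x) \<Longrightarrow> frechet_derivative f (at x) = f'"
  by (metis frechet_derivative_at)

lemma differentiable_has_derivative:
  "f differentiable (at x) \<Longrightarrow> (f has_derivative frechet_derivative f (at x)) (at x)"
  by (simp add: frechet_derivative_works)

text \<open>The recursion of \<open>Ck_on\<close> refers to \<open>frechet_derivative\<close>; on an
  open set any derivative computed by hand may stand in for it, since derivatives are
  unique.\<close>

lemma Ck_on_SucI:
  assumes "open S" "\<And>x. x \<in> S \<Longrightarrow> (f has_derivative f' x) (at x)"
    and "\<And>u. Ck_on k S (\<lambda>x. f' x u)"
  shows "Ck_on (Suc k) S f"
proof -
  have "Ck_on k S (\<lambda>x. frechet_derivative f (at x) u)" for u
    using Ck_on_cong[OF assms(1), of "\<lambda>x. frechet_derivative f (at x) u" "\<lambda>x. f' x u"]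
      frechet_derivative_eqI[OF assms(2)] assms(3) by auto
  then show ?thesis
    using assms(2) by (auto simp: differentiable_def)
qed

lemma Ck_on_bounded_linear:
  assumes "open S" "bounded_linear L" "Ck_on k S f"
  shows "Ck_on k S (\<lambda>x. L (f x))"
  using assms(3)
proof (induction k arbitrary: f)
  case 0
  then show ?case
    using assms(2) by (simp add: bounded_linear.continuous_on)
next
  case (Suc k)
  show ?case
  proof (rule Ck_on_SucI[OF assms(1)])
    show "((\<lambda>x. L (f x)) has_derivative (\<lambda>u. L (frechet_derivative f (at x) u))) (at x)" if "x \<in> S" for x
      by (rule bounded_linear.has_derivative[OF assms(2)])
        (use that Suc.prems in \<open>auto intro: differentiable_has_derivative\<close>)
    show "Ck_on k S (\<lambda>x. L (frechet_derivative f (at x) u))" for u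
      using Suc by auto
  qed
qed

lemma Ck_on_add:
  assumes "open S" "Ck_on k S f" "Ck_on k S g"
  shows "Ck_on k S (\<lambda>x. f x + g x)"
  using assms(2,3)
proof (induction k arbitrary: f g)
  case 0
  then show ?case by (simp add: continuous_on_add)
next
  case (Suc k)
  show ?case
  proof (rule Ck_on_SucI[OF assms(1)])
    show "((\<lambda>x. f x + g x) has_derivative
        (\<lambda>u. frechet_derivative f (at x) u + frechet_derivative g (at x) u)) (at x)" if "x \<in> S" for x
      using that Suc.prems by (auto intro!: has_derivative_add differentiable_has_derivative)
    show "Ck_on k S (\<lambda>x. frechet_derivative f (at x) u + frechet_derivative g (at x) u)" for u
      using Suc by auto
  qed
qed

text \<open>The product rule returns a sum of values of the same \<open>B\<close>, so the induction
  closes; \<open>Ck_on_SucD\<close> lowers the undifferentiated factor by one order.\<close>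

lemma Ck_on_bilinear:
  assumes "open S" "bounded_bilinear B" "Ck_on k S f" "Ck_on k S g"
  shows "Ck_on k S (\<lambda>x. B (f x) (g x))"
  using assms(3,4)
proof (induction k arbitrary: f g)
  case 0
  then show ?case using bounded_bilinear.continuous_on[OF assms(2)] by auto
next
  case (Suc k)
  show ?case
  proof (rule Ck_on_SucI[OF assms(1)])
    show "((\<lambda>x. B (f x) (g x)) has_derivative
        (\<lambda>u. B (f x) (frechet_derivative g (at x) u) + B (frechet_derivative f (at x) u) (g x))) (at x)"
      if "x \<in> S" for x
      by (rule bounded_bilinear.FDERIV[OF assms(2)])
        (use that Suc.prems in \<open>auto intro!: differentiable_has_derivative\<close>)
    show "Ck_on k S (\<lambda>x. B (f x) (frechet_derivative g (at x) u) + B (frechet_derivative f (at x) u) (g x))" for u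
      using Suc.prems Ck_on_SucD[OF Suc.prems(1)] Ck_on_SucD[OF Suc.prems(2)]
      by (intro Ck_on_add[OF assms(1)] Suc.IH) auto
  qed
qed

lemma Ck_on_sum:
  assumes "open S" "\<And>i. i \<in> I \<Longrightarrow> Ck_on k S (f i)"
  shows "Ck_on k S (\<lambda>x. \<Sum>i\<in>I. f i x)"
  using assms(2)
proof (induction I rule: infinite_finite_induct)
  case (insert i I)
  then show ?case by (auto intro: Ck_on_add[OF assms(1)])
qed (auto simp: Ck_on_const)

text \<open>The chain rule evaluates the derivative of \<open>g\<close> at \<open>f x\<close> in a
  direction that varies with \<open>x\<close>, a shape the induction hypothesis does not cover.
  Expanding this direction in \<open>Basis\<close> leaves scalars times derivatives in fixed
  directions, composed with \<open>f\<close>.\<close>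

lemma Ck_on_compose:
  fixes f :: "'a::euclidean_space \<Rightarrow> 'b::euclidean_space" and g :: "'b \<Rightarrow> 'c::real_normed_vector"
  assumes "open S" "open T" "f ` S \<subseteq> T" "Ck_on k S f" "Ck_on k T g"
  shows "Ck_on k S (\<lambda>x. g (f x))"
  using assms(4,5)
proof (induction k arbitrary: g)
  case 0
  then show ?case
    using assms(3) continuous_on_compose2 by auto
next
  case (Suc k)
  let ?Df = "\<lambda>x. frechet_derivative f (at x)" and ?Dg = "\<lambda>x. frechet_derivative g (at x)"
  show ?case
  proof (rule Ck_on_SucI[OF assms(1)])
    fix x assume x: "x \<in> S"
    have g: "(g has_derivative ?Dg (f x)) (at (f x))" and f: "(f has_derivative ?Df x) (at x)"
      using Suc.prems assms(3) x by (auto intro!: differentiable_has_derivative)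
    have "linear (?Dg (f x))"
      using g has_derivative_linear by blast
    then have lin: "?Dg (f x) (\<Sum>b\<in>Basis. (v \<bullet> b) *\<^sub>R b) = (\<Sum>b\<in>Basis. (v \<bullet> b) *\<^sub>R ?Dg (f x) b)" for v
      by (simp add: linear_sum linear_cmul)
    have expand: "(\<Sum>b\<in>Basis. (v \<bullet> b) *\<^sub>R ?Dg (f x) b) = ?Dg (f x) v" for v
      using lin[of v] by (simp only: euclidean_representation)
    have "((\<lambda>x. g (f x)) has_derivative (\<lambda>u. ?Dg (f x) (?Df x u))) (at x)"
      using diff_chain_at[OF f g] by (simp add: o_def)
    then show "((\<lambda>x. g (f x)) has_derivative (\<lambda>u. \<Sum>b\<in>Basis. (?Df x u \<bullet> b) *\<^sub>R ?Dg (f x) b)) (at x)"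
      by (simp add: expand)
  next
    fix u
    have "Ck_on k S (\<lambda>x. ?Df x u \<bullet> b)" for b
      using Suc.prems by (auto intro!: Ck_on_bounded_linear[OF assms(1), of "\<lambda>y. y \<bullet> b"] bounded_linear_inner_left)
    moreover have "Ck_on k S (\<lambda>x. ?Dg (f x) b)" for b
      using Suc.prems Ck_on_SucD by (intro Suc.IH) auto
    ultimately show "Ck_on k S (\<lambda>x. \<Sum>b\<in>Basis. (?Df x u \<bullet> b) *\<^sub>R ?Dg (f x) b)"
      by (intro Ck_on_sum[OF assms(1)] Ck_on_bilinear[OF assms(1) bounded_bilinear_scaleR]) auto
  qed
qed

lemma smooth_on_subset: "smooth_on S f \<Longrightarrow> T \<subseteq> S \<Longrightarrow> smooth_on T f"
  by (auto simp: smooth_on_def intro: Ck_on_subset)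

lemma smooth_on_cong:
  "open S \<Longrightarrow> (\<And>x. x \<in> S \<Longrightarrow> f x = g x) \<Longrightarrow> smooth_on S f \<longleftrightarrow> smooth_on S g"
  using Ck_on_cong[of S f g] by (simp add: smooth_on_def)

lemma smooth_on_local:
  "(\<And>x. x \<in> S \<Longrightarrow> \<exists>U. open U \<and> x \<in> U \<and> smooth_on U f) \<Longrightarrow> smooth_on S f"
  unfolding smooth_on_def by (meson Ck_on_local)

lemma smooth_on_const: "smooth_on S (\<lambda>x. c)"
  by (simp add: smooth_on_def Ck_on_const)

lemma smooth_on_bounded_linear:
  "open S \<Longrightarrow> bounded_linear L \<Longrightarrow> smooth_on S f \<Longrightarrow> smooth_on S (\<lambda>x. L (f x))"
  by (simp add: smooth_on_def Ck_on_bounded_linear)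

lemma smooth_on_id: "open S \<Longrightarrow> smooth_on S (\<lambda>x. x)"
  unfolding smooth_on_def
proof
  fix k show "Ck_on k S (\<lambda>x. x)" if "open S"
    using that
    by (cases k) (auto intro!: Ck_on_SucI[where f' = "\<lambda>_ u. u"] Ck_on_const simp: continuous_on_id)
qed

lemma smooth_on_linear:
  "open S \<Longrightarrow> bounded_linear L \<Longrightarrow> smooth_on S L"
  using smooth_on_bounded_linear[OF _ _ smooth_on_id] by blast

lemma smooth_on_add:
  "open S \<Longrightarrow> smooth_on S f \<Longrightarrow> smooth_on S g \<Longrightarrow> smooth_on S (\<lambda>x. f x + g x)"
  by (simp add: smooth_on_def Ck_on_add)

lemma smooth_on_sum:
  "open S \<Longrightarrow> (\<And>i. i \<in> I \<Longrightarrow> smooth_on S (f i)) \<Longrightarrow> smooth_on S (\<lambda>x. \<Sum>i\<in>I. f i x)"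
  by (simp add: smooth_on_def Ck_on_sum)

lemma smooth_on_bilinear:
  "open S \<Longrightarrow> bounded_bilinear B \<Longrightarrow> smooth_on S f \<Longrightarrow> smooth_on S g \<Longrightarrow> smooth_on S (\<lambda>x. B (f x) (g x))"
  by (simp add: smooth_on_def Ck_on_bilinear)

lemma smooth_on_mult:
  fixes f g :: "_ \<Rightarrow> real"
  shows "open S \<Longrightarrow> smooth_on S f \<Longrightarrow> smooth_on S g \<Longrightarrow> smooth_on S (\<lambda>x. f x * g x)"
  using smooth_on_bilinear[OF _ bounded_bilinear_mult] .

lemma smooth_on_diff:
  assumes "open S" "smooth_on S f" "smooth_on S g"
  shows "smooth_on S (\<lambda>x. f x - g x)"
  using smooth_on_add[OF assms(1,2) smooth_on_bounded_linear[OF assms(1) bounded_linear_minus[OF bounded_linear_ident] assms(3)]]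
  by simp

lemma smooth_on_compose:
  fixes f :: "'a::euclidean_space \<Rightarrow> 'b::euclidean_space" and g :: "'b \<Rightarrow> 'c::real_normed_vector"
  shows "open S \<Longrightarrow> open T \<Longrightarrow> f ` S \<subseteq> T \<Longrightarrow> smooth_on S f \<Longrightarrow> smooth_on T g \<Longrightarrow> smooth_on S (\<lambda>x. g (f x))"
  unfolding smooth_on_def using Ck_on_compose by blast

lemma smooth_on_continuous: "smooth_on S f \<Longrightarrow> continuous_on S f"
  by (metis Ck_on.simps(1) smooth_on_def)

lemma smooth_on_has_derivative:
  "smooth_on S f \<Longrightarrow> x \<in> S \<Longrightarrow> (f has_derivative frechet_derivative f (at x)) (at x)"
  unfolding smooth_on_def by (metis Ck_on.simps(2) differentiable_has_derivative)

lemma smooth_on_continuous_derivative: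
  "smooth_on S f \<Longrightarrow> continuous_on S (\<lambda>x. frechet_derivative f (at x) u)"
  unfolding smooth_on_def by (metis Ck_on.simps)

text \<open>The derivative is \<open>- u\<close> times the square of \<open>inverse\<close>, so
  regularity of \<open>inverse\<close> at order \<open>k\<close> feeds order
  \<open>k + 1\<close>.\<close>

lemma smooth_on_inverse: "smooth_on (- {0::real}) inverse"
  unfolding smooth_on_def
proof
  fix k show "Ck_on k (- {0::real}) inverse"
  proof (induction k)
    case 0
    then show ?case by (auto intro!: continuous_intros)
  next
    case (Suc k)
    show ?case
    proof (rule Ck_on_SucI)
      show "Ck_on k (- {0}) (\<lambda>x. - (inverse x * u * inverse x :: real))" for u
      proof -
        have "Ck_on k (- {0}) (\<lambda>x::real. (- u) * (inverse x * inverse x))"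
          by (intro Ck_on_bilinear[OF _ bounded_bilinear_mult] Suc Ck_on_const) auto
        then show ?thesis by (simp add: mult_ac)
      qed
    qed (auto intro!: has_derivative_inverse')
  qed
qed

lemma smooth_on_divide:
  fixes f g :: "_ \<Rightarrow> real"
  assumes "open S" "smooth_on S f" "smooth_on S g" "\<And>x. x \<in> S \<Longrightarrow> g x \<noteq> 0"
  shows "smooth_on S (\<lambda>x. f x / g x)"
proof -
  have "smooth_on S (\<lambda>x. inverse (g x))"
    by (rule smooth_on_compose[OF _ _ _ _ smooth_on_inverse]) (use assms in auto)
  then show ?thesis
    using smooth_on_mult[OF assms(1,2)] by (simp add: field_class.field_divide_inverse)
qed

section \<open>Smooth cutoff functions\<close>

text \<open>The cutoff proper is \<open>flat 0\<close>, that is exp(-1/t) extended by 0. The powers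
  of \<open>inverse t\<close> are included because derivatives of members are linear combinations of
  members.\<close>

definition flat :: "nat \<Rightarrow> real \<Rightarrow> real" where
  "flat m t = (if t > 0 then inverse t ^ m * exp (- inverse t) else 0)"

text \<open>Substituting x = 1/t turns the limit from the right into the fact that exp outgrows
  \<open>x ^ m\<close>; from the left \<open>flat m\<close> is 0.\<close>

lemma flat_tendsto_0: "(flat m \<longlongrightarrow> 0) (at 0)"
proof -
  have "((\<lambda>t. inverse t ^ m * exp (- inverse t)) \<longlongrightarrow> (0::real)) (at_right 0)"
  proof -
    have "((\<lambda>x. x ^ m / exp x) \<longlongrightarrow> (0::real)) at_top"
      by (rule tendsto_power_div_exp_0)
    then have "((\<lambda>t. inverse t ^ m / exp (inverse t)) \<longlongrightarrow> (0::real)) (at_right 0)"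
      using filterlim_compose filterlim_inverse_at_top_right by blast
    then show ?thesis by (simp add: exp_minus divide_inverse)
  qed
  then have "(flat m \<longlongrightarrow> 0) (at_right 0)"
    by (rule Lim_transform_eventually) (auto simp: flat_def eventually_at_filter)
  moreover have "(flat m \<longlongrightarrow> 0) (at_left 0)"
    by (rule tendsto_eventually) (auto simp: flat_def eventually_at_filter)
  ultimately show ?thesis
    by (simp add: filterlim_at_split)
qed

lemma flat_has_derivative:
  "(flat m has_real_derivative (flat (m + 2) t - m * flat (m + 1) t)) (at t)"
proof -
  consider "t > 0" | "t < 0" | "t = 0" by linarith
  then show ?thesis
  proof cases
    case 1
    have "((\<lambda>t. inverse t ^ m * exp (- inverse t)) has_real_derivative
        (flat (m + 2) t - m * flat (m + 1) t)) (at t)"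
      using 1 by (auto intro!: derivative_eq_intros simp: flat_def) (cases m; auto simp: algebra_simps)
    then show ?thesis
      by (rule has_field_derivative_transform_within_open[where S="{0<..}"]) (use 1 in \<open>auto simp: flat_def\<close>)
  next
    case 2
    have "((\<lambda>t. 0) has_real_derivative (flat (m + 2) t - m * flat (m + 1) t)) (at t)"
      using 2 by (auto simp: flat_def)
    then show ?thesis
      by (rule has_field_derivative_transform_within_open[where S="{..<0}"]) (use 2 in \<open>auto simp: flat_def\<close>)
  next
    case 3
    \<comment> \<open>At 0 the difference quotient of \<open>flat m\<close> is
      \<open>flat (Suc m)\<close>.\<close>
    have "((\<lambda>h. (flat m (0 + h) - flat m 0) / h) \<longlongrightarrow> 0) (at 0)"
      by (rule Lim_transform_eventually[OF flat_tendsto_0[of "Suc m"]])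
        (auto simp: flat_def eventually_at_filter field_simps)
    then show ?thesis
      using 3 by (simp add: DERIV_def flat_def)
  qed
qed

lemma smooth_on_flat: "smooth_on UNIV (flat m)"
  unfolding smooth_on_def
proof
  fix k show "Ck_on k UNIV (flat m)"
  proof (induction k arbitrary: m)
    case 0
    then show ?case
      using flat_has_derivative by (auto intro: continuous_at_imp_continuous_on DERIV_isCont)
  next
    case (Suc k)
    show ?case
    proof (rule Ck_on_SucI)
      show "(flat m has_derivative (*) (flat (m + 2) x - m * flat (m + 1) x)) (at x)" for x
        using flat_has_derivative[of m x] by (simp add: has_field_derivative_def)
      show "Ck_on k UNIV (\<lambda>x. (flat (m + 2) x - m * flat (m + 1) x) * u)" for u
      proof -
        have "Ck_on k UNIV (\<lambda>x. u * flat (m + 2) x + (- (m * u)) * flat (m + 1) x)"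
          by (intro Ck_on_add Ck_on_bilinear[OF _ bounded_bilinear_mult] Ck_on_const Suc open_UNIV)
        then show ?thesis by (simp add: algebra_simps)
      qed
    qed auto
  qed
qed

lemma flat_pos_iff: "flat 0 t > 0 \<longleftrightarrow> t > 0" and flat_nonneg: "flat 0 t \<ge> 0"
  by (auto simp: flat_def)

text \<open>The standard smooth transition, constant outside the interval from -1 to 1. The
  arguments 1 + t and 1 - t have sum 2, so at least one summand of the denominator is
  positive.\<close>

definition step :: "real \<Rightarrow> real" where
  "step t = flat 0 (1 + t) / (flat 0 (1 + t) + flat 0 (1 - t))"

lemma step_denominator_pos: "flat 0 (1 + t) + flat 0 (1 - t) > 0"
  using flat_pos_iff[of "1 + t"] flat_pos_iff[of "1 - t"] flat_nonneg[of "1 + t"] flat_nonneg[of "1 - t"]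
  by linarith

lemma smooth_on_flat_compose: 
  assumes "open S" "smooth_on S f"
  shows "smooth_on S (\<lambda>x. flat m (f x))"
  by (rule smooth_on_compose[OF _ _ _ _ smooth_on_flat]) (use assms in auto)

lemma smooth_on_step: "smooth_on UNIV step"
  unfolding step_def
  using step_denominator_pos
  by (intro smooth_on_divide smooth_on_add smooth_on_flat_compose smooth_on_diff smooth_on_const
      smooth_on_id open_UNIV) (auto simp: less_le)

lemma step_range: "0 \<le> step t" "step t \<le> 1"
  using step_denominator_pos[of t] flat_nonneg[of "1 + t"] flat_nonneg[of "1 - t"]
  by (auto simp: step_def field_simps)

lemma step_eq_0: "t \<le> -1 \<Longrightarrow> step t = 0"
  by (simp add: step_def flat_def)

lemma step_eq_1: "t \<ge> 1 \<Longrightarrow> step t = 1"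
  using flat_pos_iff[of "1 + t"] by (simp add: step_def) (simp add: flat_def)

section \<open>Alternating multilinear functions\<close>

text \<open>Stated for families of vectors rather than matrices: a top form read through a chart and
  \<open>det\<close> as a function of the rows both have this shape.\<close>

definition alternating :: "(('n::finite \<Rightarrow> real ^ 'n) \<Rightarrow> real) \<Rightarrow> bool" where
  "alternating D \<longleftrightarrow>
     (\<forall>v i a b u w. D (v(i := a *\<^sub>R u + b *\<^sub>R w)) = a * D (v(i := u)) + b * D (v(i := w))) \<and>
     (\<forall>v i j. i \<noteq> j \<and> v i = v j \<longrightarrow> D v = 0)"

lemma alternating_linear:
  "alternating D \<Longrightarrow> D (v(i := a *\<^sub>R u + b *\<^sub>R w)) = a * D (v(i := u)) + b * D (v(i := w))"
  by (simp add: alternating_def)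

lemma alternating_eq_0: "alternating D \<Longrightarrow> i \<noteq> j \<Longrightarrow> v i = v j \<Longrightarrow> D v = 0"
  unfolding alternating_def by blast

lemma alternating_scale: "alternating D \<Longrightarrow> D (v(i := a *\<^sub>R u)) = a * D (v(i := u))"
  using alternating_linear[of D v i a u 0 u] by simp

lemma alternating_plus:
  "alternating D \<Longrightarrow> D (v(i := u + w)) = D (v(i := u)) + D (v(i := w))"
  using alternating_linear[of D v i 1 u 1 w] by simp

text \<open>With \<open>v m + v n\<close> in both slots \<open>D\<close> is 0; expanding there
  leaves only the two mixed terms.\<close>

lemma alternating_swap:
  assumes "alternating D" "m \<noteq> n"
  shows "D (\<lambda>i. v (Transposition.transpose m n i)) = - D v"
proof -
  define w where "w x y = v(m := x, n := y)" for x y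
  have add1: "D (w (x + x') y) = D (w x y) + D (w x' y)" for x x' y
    using alternating_plus[OF assms(1), of "v(n := y)" m x x'] assms(2)
    by (simp add: w_def fun_upd_twist)
  have add2: "D (w x (y + y')) = D (w x y) + D (w x y')" for x y y'
    using alternating_plus[OF assms(1), of "v(m := x)" n y y'] by (simp add: w_def)
  have diag: "D (w x x) = 0" for x
    by (rule alternating_eq_0[OF assms]) (use assms(2) in \<open>simp add: w_def\<close>)
  have "0 = D (w (v m + v n) (v m + v n))"
    by (simp add: diag)
  also have "\<dots> = D (w (v m) (v n)) + D (w (v n) (v m))"
    by (simp only: add1 add2) (simp add: diag)
  finally have "D (w (v n) (v m)) = - D (w (v m) (v n))"
    by linarith
  moreover have "w (v m) (v n) = v"
    by (simp add: w_def)
  moreover have "w (v n) (v m) = (\<lambda>i. v (Transposition.transpose m n i))"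
    by (auto simp: w_def fun_eq_iff transpose_def)
  ultimately show ?thesis by simp
qed

lemma alternating_det: "alternating (\<lambda>v. det (\<chi> i. v i))"
  unfolding alternating_def
proof (intro conjI allI impI)
  fix v :: "'a \<Rightarrow> real ^ 'a" and i a b u w
  have upd: "(\<chi> k. (v(i := x)) k) = (\<chi> k. if k = i then x else v k)" for x
    by (simp add: vec_eq_iff)
  show "det (\<chi> k. (v(i := a *\<^sub>R u + b *\<^sub>R w)) k) =
      a * det (\<chi> k. (v(i := u)) k) + b * det (\<chi> k. (v(i := w)) k)"
    using det_row_add[of i "\<lambda>_. a *s u" "\<lambda>_. b *s w" v] det_row_mul[of i a "\<lambda>_. u" v]
      det_row_mul[of i b "\<lambda>_. w" v]
    unfolding upd scalar_mult_eq_scaleR by simp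
next
  fix v :: "'a \<Rightarrow> real ^ 'a" and i j assume "i \<noteq> j \<and> v i = v j"
  then show "det (\<chi> k. v k) = 0"
    using det_identical_rows[of i j "\<chi> k. v k"] by (simp add: row_def vec_eq_iff)
qed

text \<open>The factor \<open>d\<close> depends on \<open>A\<close> alone, uniformly in
  \<open>D\<close> and \<open>B\<close>, so evaluating it on \<open>det\<close> determines it for
  every alternating \<open>D\<close>. It is multiplicative in \<open>A\<close>; hence matrices with
  a zero row, diagonal matrices, transpositions and shears suffice.\<close>

lemma alternating_matrix_mult_factor:
  fixes A :: "real ^ 'n ^ 'n"
  shows "\<exists>d. \<forall>D B. alternating D \<longrightarrow> D (($) (A ** B)) = d * D (($) B)"
proof (induction A rule: induct_matrix_elementary)
  case (1 A B)
  then obtain a b where "\<forall>D C. alternating D \<longrightarrow> D (($) (A ** C)) = a * D (($) C)"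
    and "\<forall>D C. alternating D \<longrightarrow> D (($) (B ** C)) = b * D (($) C)"
    by blast
  then have "\<forall>D C. alternating D \<longrightarrow> D (($) (A ** B ** C)) = (a * b) * D (($) C)"
    by (simp add: matrix_mul_assoc[symmetric] mult.assoc)
  then show ?case by blast
next
  case (2 A i)
  have "D (($) (A ** B)) = 0 * D (($) B)" if "alternating D" for D B
  proof -
    have "(A ** B) $ i = 0"
      using 2 by (simp add: vec_eq_iff row_def matrix_matrix_mult_def)
    then have "($) (A ** B) = (($) (A ** B))(i := 0 *\<^sub>R 0)"
      by auto
    then show ?thesis
      using alternating_scale[OF that, of "($) (A ** B)" i 0 0] by simp
  qed
  then show ?case by blast
next
  case (3 A)
  have "D (($) (A ** B)) = (\<Prod>i\<in>UNIV. A $ i $ i) * D (($) B)" if D: "alternating D" for D B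
  proof -
    have "(A ** B) $ i $ j = A $ i $ i * B $ i $ j" for i j
    proof -
      have "(A ** B) $ i $ j = (\<Sum>k\<in>UNIV. A $ i $ k * B $ k $ j)"
        by (simp add: matrix_matrix_mult_def)
      also have "\<dots> = (\<Sum>k\<in>{i}. A $ i $ k * B $ k $ j)"
        by (rule sum.mono_neutral_right) (use 3 in auto)
      finally show ?thesis by simp
    qed
    then have rows: "($) (A ** B) = (\<lambda>i. if i \<in> UNIV then A $ i $ i *\<^sub>R B $ i else B $ i)"
      by (simp add: fun_eq_iff vec_eq_iff)
    have "D (\<lambda>i. if i \<in> S then A $ i $ i *\<^sub>R B $ i else B $ i) = (\<Prod>i\<in>S. A $ i $ i) * D (($) B)"
      if "finite S" for S
      using that
    proof induction
      case (insert k S)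
      let ?v = "\<lambda>i. if i \<in> S then A $ i $ i *\<^sub>R B $ i else B $ i"
      have "(\<lambda>i. if i \<in> insert k S then A $ i $ i *\<^sub>R B $ i else B $ i) = ?v(k := A $ k $ k *\<^sub>R B $ k)"
        by auto
      moreover have "?v(k := B $ k) = ?v"
        using insert by auto
      ultimately show ?case
        using insert alternating_scale[OF D, of ?v k "A $ k $ k" "B $ k"] by simp
    qed simp
    from this[OF finite_class.finite_UNIV] show ?thesis
      unfolding rows .
  qed
  then show ?case by blast
next
  case (4 m n)
  have "D (($) ((\<chi> i j. mat 1 $ i $ Transposition.transpose m n j) ** B)) = -1 * D (($) B)"
    if D: "alternating D" for D B
  proof -
    have "(\<Sum>k\<in>UNIV. (if i = Transposition.transpose m n k then 1 else 0) * B $ k $ j) =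
        B $ (Transposition.transpose m n i) $ j" for i j
    proof -
      have "i = Transposition.transpose m n k \<longleftrightarrow> k = Transposition.transpose m n i" for k
        by (metis transpose_involutory)
      then have "(if i = Transposition.transpose m n k then 1 else 0) * B $ k $ j =
          (if k = Transposition.transpose m n i then B $ k $ j else 0)" for k
        by simp
      then show ?thesis by simp
    qed
    then have "($) ((\<chi> i j. mat 1 $ i $ Transposition.transpose m n j) ** B) =
        (\<lambda>i. B $ (Transposition.transpose m n i))"
      by (simp add: fun_eq_iff vec_eq_iff matrix_matrix_mult_def mat_def)
    then show ?thesis
      using alternating_swap[OF D 4] by simp
  qed
  then show ?case by blast
next
  case (5 m n c)
  have "D (($) ((\<chi> i j. if i = m \<and> j = n then c else of_bool (i = j)) ** B)) = 1 * D (($) B)"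
    if D: "alternating D" for D B
  proof -
    have "(\<Sum>k\<in>UNIV. (if i = m \<and> k = n then c else of_bool (i = k)) * B $ k $ j) =
        ((($) B)(m := 1 *\<^sub>R B $ m + c *\<^sub>R B $ n)) i $ j" for i j
    proof -
      have "(\<Sum>k\<in>UNIV. (if i = m \<and> k = n then c else of_bool (i = k)) * B $ k $ j) =
        (\<Sum>k\<in>UNIV. (if k = n then (if i = m then c * B $ k $ j else 0) else 0) + (if k = i then B $ k $ j else 0))"
        using 5 by (intro sum.cong) auto
      then show ?thesis by (simp add: sum.distrib)
    qed
    then have "($) ((\<chi> i j. if i = m \<and> j = n then c else of_bool (i = j)) ** B) =
        (($) B)(m := 1 *\<^sub>R B $ m + c *\<^sub>R B $ n)"
      by (simp add: fun_eq_iff vec_eq_iff matrix_matrix_mult_def)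
    moreover have "D ((($) B)(m := B $ n)) = 0"
      by (rule alternating_eq_0[OF D 5]) (use 5 in auto)
    ultimately show ?thesis
      by (simp only: alternating_linear[OF D]) simp
  qed
  then show ?case by blast
qed

text \<open>With the identity as second factor, \<open>D\<close> and \<open>det\<close> acquire the
  same multiplier, and \<open>det\<close> is 1 at the identity.\<close>

lemma alternating_eq_det:
  fixes D :: "('n::finite \<Rightarrow> real ^ 'n) \<Rightarrow> real"
  assumes "alternating D"
  shows "D v = det (\<chi> i. v i) * D (\<lambda>i. axis i 1)"
proof -
  obtain d where d: "\<And>D' B. alternating D' \<Longrightarrow> D' (($) ((\<chi> i. v i) ** B)) = d * D' (($) B)"
    using alternating_matrix_mult_factor[of "\<chi> i. v i"] by blast
  have d_eq: "D v = d * D (\<lambda>i. axis i 1)" if "alternating D" for D :: "('n \<Rightarrow> real ^ 'n) \<Rightarrow> real"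
  proof -
    have "($) (mat 1 :: real ^ 'n ^ 'n) = (\<lambda>i. axis i 1)"
      by (simp add: fun_eq_iff vec_eq_iff mat_def axis_def)
    moreover have "($) (\<chi> i. v i) = v"
      by auto
    ultimately show ?thesis
      using d[OF that, of "mat 1"] by simp
  qed
  moreover have "(\<chi> i. axis i (1::real)) = (mat 1 :: real ^ 'n ^ 'n)"
    by (simp add: vec_eq_iff mat_def axis_def)
  ultimately show ?thesis
    using d_eq[OF assms] d_eq[OF alternating_det] by simp
qed

text \<open>Here \<open>\<sigma>\<close> links two index types, so more is involved than permuting
  one matrix. The left side is an alternating function of the rows of \<open>A\<close> with value 1
  at the identity, and \<open>det\<close> is the only such function.\<close>

lemma det_reindex:
  fixes A :: "real ^ 'n ^ 'n" and \<sigma> :: "'m::finite \<Rightarrow> 'n::finite"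
  assumes "bij \<sigma>"
  shows "det (\<chi> i j. A $ \<sigma> i $ \<sigma> j) = det A"
proof -
  define D where "D v = det (\<chi> i j. v (\<sigma> i) $ \<sigma> j)" for v :: "'n \<Rightarrow> real ^ 'n"
  define r where "r x = (\<chi> j. x $ \<sigma> j)" for x :: "real ^ 'n"
  have D: "D v = det (\<chi> i. r (v (\<sigma> i)))" for v
    by (simp add: D_def r_def)
  have "alternating D"
    unfolding alternating_def
  proof (intro conjI allI impI)
    fix v :: "'n \<Rightarrow> real ^ 'n" and i a b u w
    have upd: "(\<lambda>k. r ((v(i := x)) (\<sigma> k))) = (\<lambda>k. r (v (\<sigma> k)))(inv \<sigma> i := r x)" for x
      using assms by (auto simp: fun_eq_iff bij_is_inj bij_is_surj surj_f_inv_f)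
    have r: "r (a *\<^sub>R u + b *\<^sub>R w) = a *\<^sub>R r u + b *\<^sub>R r w"
      by (simp add: r_def vec_eq_iff)
    show "D (v(i := a *\<^sub>R u + b *\<^sub>R w)) = a * D (v(i := u)) + b * D (v(i := w))"
      unfolding D upd r by (rule alternating_linear[OF alternating_det])
  next
    fix v :: "'n \<Rightarrow> real ^ 'n" and i j assume "i \<noteq> j \<and> v i = v j"
    then show "D v = 0"
      unfolding D using assms
      by (intro alternating_eq_0[OF alternating_det, of "inv \<sigma> i" "inv \<sigma> j"])
        (auto simp: bij_is_surj surj_f_inv_f dest: bij_imp_bij_inv bij_is_inj inj_eq)
  qed
  moreover have "D (\<lambda>i. axis i 1) = 1"
  proof -
    have "(\<chi> i j. axis (\<sigma> i) (1::real) $ \<sigma> j) = mat 1"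
      using assms by (simp add: vec_eq_iff mat_def axis_def bij_is_inj inj_eq eq_commute)
    then show ?thesis by (simp add: D_def)
  qed
  ultimately have "D (($) A) = det A"
    using alternating_eq_det[of D "($) A"] by simp
  then show ?thesis by (simp add: D_def)
qed

section \<open>Images of differentiable maps for arbitrary finite index types\<close>

text \<open>
  The change of variables theory of the library requires a well-ordered index type.  Every finite
  type has a well-ordered copy, and permuting coordinates preserves integrals.
\<close>

typedef 'a ordered = "UNIV :: 'a set" by simp

lemma bij_Rep_ordered: "bij Rep_ordered"
  by (metis Abs_ordered_inverse Rep_ordered_inject UNIV_I bijI' )

instance ordered :: (finite) finite
proof
  show "finite (UNIV :: 'a ordered set)"
    using bij_Rep_ordered by (metis bij_betw_finite finite)
qed

definition ordered_rank :: "'a::finite ordered \<Rightarrow> nat" where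
  "ordered_rank = (SOME f. inj f)"

lemma inj_ordered_rank: "inj (ordered_rank :: 'a::finite ordered \<Rightarrow> nat)"
proof -
  have "\<exists>f :: 'a ordered \<Rightarrow> nat. inj f"
    using finite_imp_inj_to_nat_seg[OF finite[of UNIV]] by blast
  then show ?thesis
    unfolding ordered_rank_def by (rule someI_ex)
qed

instantiation ordered :: (finite) wellorder
begin

definition "x \<le> y \<longleftrightarrow> ordered_rank x \<le> ordered_rank y"

definition "x < y \<longleftrightarrow> ordered_rank x < ordered_rank y"

instance
proof
  fix x y :: "'a ordered"
  show "x = y" if "x \<le> y" "y \<le> x"
    using that by (simp add: less_eq_ordered_def inj_eq[OF inj_ordered_rank])
  fix P and a :: "'a ordered"
  show "P a" if "\<And>x. (\<And>y. y < x \<Longrightarrow> P y) \<Longrightarrow> P x"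
  proof (induction a rule: measure_induct_rule[of ordered_rank])
    case (less x)
    then show ?case by (rule that) (use less in \<open>simp add: less_ordered_def\<close>)
  qed
qed (auto simp: less_eq_ordered_def less_ordered_def)

end

definition reindex :: "('m \<Rightarrow> 'n) \<Rightarrow> 'a ^ 'n \<Rightarrow> 'a ^ 'm" where
  "reindex \<sigma> x = (\<chi> i. x $ \<sigma> i)"

lemma reindex_nth [simp]: "reindex \<sigma> x $ i = x $ \<sigma> i"
  by (simp add: reindex_def)

lemma reindex_inv:
  assumes "bij \<sigma>"
  shows "reindex \<sigma> (reindex (inv \<sigma>) x) = x" "reindex (inv \<sigma>) (reindex \<sigma> y) = y"
  using assms by (simp_all add: vec_eq_iff bij_is_inj bij_is_surj surj_f_inv_f)

lemma bounded_linear_reindex: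
  "bounded_linear (reindex \<sigma> :: real ^ 'n \<Rightarrow> real ^ 'm)" for \<sigma> :: "'m::finite \<Rightarrow> 'n::finite"
  unfolding linear_conv_bounded_linear[symmetric] by (rule linearI) (simp_all add: vec_eq_iff)

lemma norm_reindex:
  fixes \<sigma> :: "'m::finite \<Rightarrow> 'n::finite" and x :: "real ^ 'n"
  assumes "bij \<sigma>"
  shows "norm (reindex \<sigma> x) = norm x"
  using sum.reindex_bij_betw[OF assms, of "\<lambda>i. (x $ i)\<^sup>2"]
  by (simp add: norm_vec_def L2_set_def)

lemma reindex_cbox:
  fixes \<sigma> :: "'m::finite \<Rightarrow> 'n::finite" and a b :: "real ^ 'n"
  assumes "bij \<sigma>"
  shows "reindex \<sigma> ` cbox a b = cbox (reindex \<sigma> a) (reindex \<sigma> b)"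
proof -
  have "x \<in> reindex \<sigma> ` cbox a b" if "x \<in> cbox (reindex \<sigma> a) (reindex \<sigma> b)" for x
  proof
    show "x = reindex \<sigma> (reindex (inv \<sigma>) x)"
      by (simp add: reindex_inv assms)
    have "a $ \<sigma> i \<le> x $ i \<and> x $ i \<le> b $ \<sigma> i" for i
      using that by (simp add: mem_box_cart)
    from this[of "inv \<sigma> _"] show "reindex (inv \<sigma>) x \<in> cbox a b"
      using assms by (simp add: mem_box_cart bij_is_surj surj_f_inv_f)
  qed
  then show ?thesis
    by (auto simp: mem_box_cart)
qed

lemma content_reindex:
  fixes \<sigma> :: "'m::finite \<Rightarrow> 'n::finite" and a b :: "real ^ 'n"
  assumes "bij \<sigma>"
  shows "measure lborel (reindex \<sigma> ` cbox a b) = measure lborel (cbox a b)"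
proof (cases "cbox a b = {}")
  case False
  then have "cbox (reindex \<sigma> a) (reindex \<sigma> b) \<noteq> {}"
    by (metis assms image_is_empty reindex_cbox)
  then show ?thesis
    using False prod.reindex_bij_betw[OF assms, of "\<lambda>i. b $ i - a $ i"]
    by (simp add: reindex_cbox[OF assms] content_cbox_cart)
qed simp

text \<open>An integral over the whole space is tested on boxes that contain a large ball. A
  coordinate permutation preserves balls around 0, maps boxes to boxes and keeps their content, so
  the same radius \<open>B\<close> works.\<close>

lemma has_integral_reindex_UNIV:
  fixes \<sigma> :: "'m::finite \<Rightarrow> 'n::finite" and f :: "real ^ 'n \<Rightarrow> real"
  assumes "bij \<sigma>" "(f has_integral I) UNIV"
  shows "((\<lambda>x. f (reindex (inv \<sigma>) x)) has_integral I) UNIV"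
  unfolding has_integral'[of _ _ UNIV]
proof (intro allI impI)
  fix e :: real assume "e > 0"
  then obtain B where "B > 0" and B: "\<And>a b. ball 0 B \<subseteq> cbox a b \<Longrightarrow>
      \<exists>z. (f has_integral z) (cbox a b) \<and> norm (z - I) < e"
    using assms(2) unfolding has_integral'[of _ _ UNIV] by auto
  have inv: "bij (inv \<sigma>)"
    by (rule bij_imp_bij_inv[OF assms(1)])
  have "\<exists>z. ((\<lambda>x. f (reindex (inv \<sigma>) x)) has_integral z) (cbox a b) \<and> norm (z - I) < e"
    if ab: "ball 0 B \<subseteq> cbox a b" for a b :: "real ^ 'm"
  proof -
    let ?a = "reindex (inv \<sigma>) a" and ?b = "reindex (inv \<sigma>) b"
    have "ball 0 B \<subseteq> reindex (inv \<sigma>) ` cbox a b"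
    proof
      fix x :: "real ^ 'n" assume "x \<in> ball 0 B"
      then have "reindex \<sigma> x \<in> cbox a b"
        using ab by (auto simp: norm_reindex[OF assms(1)])
      then show "x \<in> reindex (inv \<sigma>) ` cbox a b"
        by (metis assms(1) image_eqI reindex_inv(2))
    qed
    then obtain z where z: "(f has_integral z) (cbox ?a ?b)" "norm (z - I) < e"
      using B reindex_cbox[OF inv] by metis
    have "((\<lambda>x. f (reindex (inv \<sigma>) x)) has_integral (1 / 1) *\<^sub>R z) (reindex \<sigma> ` cbox ?a ?b)"
      by (rule has_integral_twiddle[OF _ reindex_inv[OF assms(1)] _ _ _ _ z(1)])
        (auto simp: reindex_cbox assms(1) inv content_reindex[OF inv, unfolded reindex_cbox[OF inv]]
          intro!: linear_continuous_at bounded_linear_reindex)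
    then show ?thesis
      using z(2) by (auto simp: reindex_cbox assms(1) reindex_inv)
  qed
  then show "\<exists>B>0. \<forall>a b. ball 0 B \<subseteq> cbox a b \<longrightarrow>
      (\<exists>z. ((\<lambda>x. if x \<in> UNIV then f (reindex (inv \<sigma>) x) else 0) has_integral z) (cbox a b) \<and> norm (z - I) < e)"
    using \<open>B > 0\<close> by auto
qed

lemma has_integral_reindex:
  fixes \<sigma> :: "'m::finite \<Rightarrow> 'n::finite" and f :: "real ^ 'n \<Rightarrow> real"
  assumes "bij \<sigma>" "(f has_integral I) S"
  shows "((\<lambda>x. f (reindex (inv \<sigma>) x)) has_integral I) (reindex (inv \<sigma>) -` S)"
proof -
  have "((\<lambda>x. if x \<in> S then f x else 0) has_integral I) UNIV"
    using assms(2) by (simp add: has_integral_restrict_UNIV)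
  from has_integral_reindex_UNIV[OF assms(1) this] show ?thesis
    by (subst has_integral_restrict_UNIV[symmetric]) (simp add: if_distrib)
qed

text \<open>Conjugation with a coordinate permutation moves \<open>f\<close> to the ordered copy of
  the index type, and the area inequality is applied there. The Jacobian determinant is unchanged
  because rows and columns are permuted alike.\<close>

lemma measure_differentiable_image_finite:
  fixes f :: "real ^ 'n::finite \<Rightarrow> real ^ 'n"
  assumes S: "S \<in> sets borel"
    and deriv: "\<And>x. x \<in> S \<Longrightarrow> (f has_derivative f' x) (at x within S)"
    and int: "(\<lambda>x. \<bar>det (matrix (f' x))\<bar>) integrable_on S"
  shows "f ` S \<in> lmeasurable" "measure lebesgue (f ` S) \<le> integral S (\<lambda>x. \<bar>det (matrix (f' x))\<bar>)"
proof -
  define \<sigma> :: "'n ordered \<Rightarrow> 'n" where "\<sigma> = Rep_ordered"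
  have \<sigma>: "bij \<sigma>" "bij (inv \<sigma>)" "inv (inv \<sigma>) = \<sigma>"
    unfolding \<sigma>_def using bij_Rep_ordered bij_imp_bij_inv inv_inv_eq by blast+
  define g :: "real ^ 'n ordered \<Rightarrow> real ^ 'n" where "g = reindex (inv \<sigma>)"
  define h :: "real ^ 'n \<Rightarrow> real ^ 'n ordered" where "h = reindex \<sigma>"
  have gh: "g (h x) = x" and hg: "h (g y) = y" for x y
    using reindex_inv[OF \<sigma>(1)] by (simp_all add: g_def h_def)
  have lin: "bounded_linear g" "bounded_linear h"
    by (simp_all add: g_def h_def bounded_linear_reindex)
  define F where "F = h \<circ> f \<circ> g"
  define F' where "F' y = h \<circ> f' (g y) \<circ> g" for y
  have det: "det (matrix (F' y)) = det (matrix (f' (g y)))" if "y \<in> g -` S" for y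
  proof -
    have g_axis: "g (axis j 1) = axis (\<sigma> j) 1" for j
      using \<sigma>(1) by (auto simp: g_def vec_eq_iff axis_def bij_is_surj surj_f_inv_f bij_is_inj)
    have "matrix (F' y) = (\<chi> i j. matrix (f' (g y)) $ \<sigma> i $ \<sigma> j)"
      by (simp add: vec_eq_iff F'_def matrix_def h_def g_axis)
    then show ?thesis
      using det_reindex[OF \<sigma>(1)] by metis
  qed
  let ?I = "integral S (\<lambda>x. \<bar>det (matrix (f' x))\<bar>)"
  have "((\<lambda>x. \<bar>det (matrix (f' x))\<bar>) has_integral ?I) S"
    using int by blast
  then have "((\<lambda>y. \<bar>det (matrix (f' (g y)))\<bar>) has_integral ?I) (g -` S)"
    unfolding g_def by (rule has_integral_reindex[OF \<sigma>(1)])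
  then have I: "((\<lambda>y. \<bar>det (matrix (F' y))\<bar>) has_integral ?I) (g -` S)"
    by (rule has_integral_eq[rotated]) (simp add: det)
  have "continuous_on UNIV g"
    using lin(1) by (simp add: linear_continuous_on)
  then have "g -` S \<in> sets borel"
    using S borel_measurable_continuous_onI measurable_sets_borel by blast
  then have meas: "g -` S \<in> sets lebesgue"
    by (metis sets_completionI_sets sets_lborel)
  have F: "(F has_derivative F' y) (at y within g -` S)" if "y \<in> g -` S" for y
  proof -
    have "(g has_derivative g) (at y within g -` S)"
      using lin(1) by (simp add: bounded_linear_imp_has_derivative)
    moreover have "(f has_derivative f' (g y)) (at (g y) within g ` (g -` S))"
      using deriv that by (auto intro: has_derivative_subset)
    ultimately have "((f \<circ> g) has_derivative (f' (g y) \<circ> g)) (at y within g -` S)"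
      by (rule diff_chain_within)
    then show ?thesis
      using bounded_linear.has_derivative[OF lin(2)] by (fastforce simp: F_def F'_def o_def)
  qed
  have image: "F ` (g -` S) = h ` f ` S"
    unfolding F_def image_comp[symmetric] using gh by (metis surj_def surj_image_vimage_eq)
  have "h ` f ` S \<in> lmeasurable" "measure lebesgue (h ` f ` S) \<le> ?I"
    using measurable_differentiable_image[OF meas F] measure_differentiable_image[OF meas F] I
    unfolding image by (auto simp: has_integral_iff)
  \<comment> \<open>The measure is expressed as the integral of 1, so that reindexing of integrals
    carries it back to \<open>real ^ 'n\<close>.\<close>
  then have "((\<lambda>x. 1 :: real) has_integral measure lebesgue (h ` f ` S)) (h ` f ` S)"
    by (simp add: has_integral_iff lmeasure_integral flip: lmeasurable_iff_integrable_on)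
  then have "((\<lambda>x. 1 :: real) has_integral measure lebesgue (h ` f ` S)) (h -` h ` f ` S)"
    unfolding h_def using has_integral_reindex[OF \<sigma>(2)] unfolding \<sigma>(3) by blast
  moreover have "h -` h ` f ` S = f ` S"
    by (rule inj_vimage_image_eq) (metis gh injI)
  ultimately have *: "((\<lambda>x. 1 :: real) has_integral measure lebesgue (h ` f ` S)) (f ` S)"
    by simp
  then show fS: "f ` S \<in> lmeasurable"
    unfolding lmeasurable_iff_integrable_on by (rule has_integral_integrable)
  show "measure lebesgue (f ` S) \<le> ?I"
    using * \<open>measure lebesgue (h ` f ` S) \<le> ?I\<close> by (simp add: lmeasure_integral[OF fS] has_integral_iff)
qed

section \<open>Charts, tangent spaces and the bracket\<close>

definition jacobian ::
  "('a, 'n::finite) chart \<Rightarrow> ('n \<Rightarrow> 'a \<Rightarrow> real) \<Rightarrow> real ^ 'n \<Rightarrow> real ^ 'n ^ 'n" where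
  "jacobian c F x = (\<chi> i j. frechet_derivative (F i \<circ> chart_inv c) (at x) (axis j 1))"

locale smooth_atlas =
  fixes M :: "'a::t2_space set" and A :: "('a, 'n::finite) chart set"
  assumes smooth_structure: "smooth_structure M A"
begin

lemma chart: "c \<in> A \<Longrightarrow> is_chart M c"
  using smooth_structure by (simp add: smooth_structure_def)

lemma chart_dom_openin: "c \<in> A \<Longrightarrow> openin (top_of_set M) (chart_dom c)"
  and open_chart_codom: "c \<in> A \<Longrightarrow> open (chart_codom c)"
  and chart_homeomorphism:
    "c \<in> A \<Longrightarrow> homeomorphism (chart_dom c) (chart_codom c) (chart_map c) (chart_inv c)"
  using chart by (auto simp: is_chart_def)

lemma chart_dom_subset: "c \<in> A \<Longrightarrow> chart_dom c \<subseteq> M"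
  using chart_dom_openin openin_imp_subset by blast

lemma chart_inv_map: "c \<in> A \<Longrightarrow> p \<in> chart_dom c \<Longrightarrow> chart_inv c (chart_map c p) = p"
  using chart_homeomorphism by (simp add: homeomorphism_def)

lemma chart_map_inv: "x \<in> chart_codom c \<Longrightarrow> chart_map c (chart_inv c x) = x"
  by (rule f_inv_into_f)

lemma chart_inv_in_dom: "x \<in> chart_codom c \<Longrightarrow> chart_inv c x \<in> chart_dom c"
  by (rule inv_into_into)

lemma continuous_on_chart_inv: "c \<in> A \<Longrightarrow> continuous_on (chart_codom c) (chart_inv c)"
  and continuous_on_chart_map: "c \<in> A \<Longrightarrow> continuous_on (chart_dom c) (chart_map c)"
  using chart_homeomorphism by (auto simp: homeomorphism_def)

lemma chart_cover: "p \<in> M \<Longrightarrow> \<exists>c\<in>A. p \<in> chart_dom c"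
  using smooth_structure by (auto simp: smooth_structure_def)

lemma open_chart_image:
  assumes "c \<in> A" "openin (top_of_set M) U"
  shows "open (chart_map c ` (chart_dom c \<inter> U))"
proof -
  have "openin (top_of_set (chart_dom c)) (chart_dom c \<inter> U)"
  proof -
    obtain T where "open T" "U = M \<inter> T"
      using assms(2) by (auto simp: openin_open)
    moreover from this have "chart_dom c \<inter> U = chart_dom c \<inter> T"
      using chart_dom_subset[OF assms(1)] by blast
    ultimately show ?thesis
      by (metis openin_open)
  qed
  then have "openin (top_of_set (chart_codom c)) (chart_map c ` (chart_dom c \<inter> U))"
    using homeomorphism_imp_open_map[OF chart_homeomorphism[OF assms(1)]] by blast
  then show ?thesis
    using open_chart_codom[OF assms(1)] openin_open_trans by blast
qed

lemma openin_chart_preimage: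
  assumes "c \<in> A" "open V"
  shows "openin (top_of_set M) {p \<in> chart_dom c. chart_map c p \<in> V}"
proof -
  have "openin (top_of_set (chart_dom c)) (chart_dom c \<inter> chart_map c -` V)"
    using continuous_openin_preimage_gen[OF continuous_on_chart_map[OF assms(1)] assms(2)] .
  then have "openin (top_of_set M) (chart_dom c \<inter> chart_map c -` V)"
    using chart_dom_openin[OF assms(1)] openin_trans by blast
  moreover have "chart_dom c \<inter> chart_map c -` V = {p \<in> chart_dom c. chart_map c p \<in> V}"
    by blast
  ultimately show ?thesis by simp
qed

lemma smooth_transition:
  "c \<in> A \<Longrightarrow> d \<in> A \<Longrightarrow>
    smooth_on (chart_map c ` (chart_dom c \<inter> chart_dom d)) (chart_map d \<circ> chart_inv c)"
  using smooth_structure unfolding smooth_structure_def smoothly_compatible_def by blast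

lemma smooth_functionsD:
  "F \<in> smooth_functions A \<Longrightarrow> c \<in> A \<Longrightarrow> smooth_on (chart_codom c) (F \<circ> chart_inv c)"
  by (simp add: smooth_functions_def)

lemma smooth_function_has_derivative:
  assumes "F \<in> smooth_functions A" "c \<in> A" "x \<in> chart_codom c"
  shows "(F \<circ> chart_inv c has_derivative frechet_derivative (F \<circ> chart_inv c) (at x)) (at x)"
  using smooth_on_has_derivative[OF smooth_functionsD] assms by blast

text \<open>The chain rule for the transition map: its derivative changes the coefficients, while
  the derivation stays the same. On non-smooth functions both sides are 0.\<close>

lemma chart_tangent_change:
  assumes c: "c \<in> A" "p \<in> chart_dom c" and d: "d \<in> A" "p \<in> chart_dom d"
  shows "\<exists>w. chart_tangent A c p u = chart_tangent A d p w"
proof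
  let ?T = "chart_map d \<circ> chart_inv c" and ?x = "chart_map c p"
  let ?S = "chart_map c ` (chart_dom c \<inter> chart_dom d)"
  show "chart_tangent A c p u = chart_tangent A d p (frechet_derivative ?T (at ?x) u)"
  proof
    fix F
    show "chart_tangent A c p u F = chart_tangent A d p (frechet_derivative ?T (at ?x) u) F"
    proof (cases "F \<in> smooth_functions A")
      case True
      have x: "?x \<in> ?S" and Tx: "?T ?x = chart_map d p"
        using c d by (auto simp: chart_inv_map)
      have S: "open ?S"
        by (rule open_chart_image[OF c(1) chart_dom_openin[OF d(1)]])
      have "(?T has_derivative frechet_derivative ?T (at ?x)) (at ?x)"
        by (rule smooth_on_has_derivative[OF smooth_transition[OF c(1) d(1)] x])
      moreover have "(F \<circ> chart_inv d has_derivative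
          frechet_derivative (F \<circ> chart_inv d) (at (?T ?x))) (at (?T ?x))"
        unfolding Tx using d by (intro smooth_function_has_derivative[OF True]) auto
      ultimately have "((F \<circ> chart_inv d) \<circ> ?T has_derivative
          frechet_derivative (F \<circ> chart_inv d) (at (?T ?x)) \<circ> frechet_derivative ?T (at ?x)) (at ?x)"
        by (rule diff_chain_at)
      then have "frechet_derivative ((F \<circ> chart_inv d) \<circ> ?T) (at ?x) =
          frechet_derivative (F \<circ> chart_inv d) (at (chart_map d p)) \<circ> frechet_derivative ?T (at ?x)"
        unfolding Tx by (rule frechet_derivative_eqI)
      moreover have "frechet_derivative ((F \<circ> chart_inv d) \<circ> ?T) (at ?x) = frechet_derivative (F \<circ> chart_inv c) (at ?x)"
        by (rule frechet_derivative_cong_open[OF S x]) (use c d in \<open>auto simp: chart_inv_map\<close>)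
      ultimately show ?thesis
        using True by (simp add: chart_tangent_def)
    qed (simp add: chart_tangent_def)
  qed
qed

lemma tangent_space_chart:
  assumes "d \<in> A" "p \<in> chart_dom d"
  shows "tangent_space A p = range (chart_tangent A d p)"
proof (intro equalityI subsetI)
  fix v assume "v \<in> tangent_space A p"
  then obtain c u where "v = chart_tangent A c p u" "c \<in> A" "p \<in> chart_dom c"
    by (auto simp: tangent_space_def)
  then show "v \<in> range (chart_tangent A d p)"
    using chart_tangent_change[OF _ _ assms, of c u] by auto
next
  fix v assume "v \<in> range (chart_tangent A d p)"
  then show "v \<in> tangent_space A p"
    unfolding tangent_space_def using assms by blast
qed

lemma chart_tangent_linear:
  assumes "c \<in> A" "p \<in> chart_dom c"
  shows "chart_tangent A c p (a *\<^sub>R u + b *\<^sub>R w) = (\<lambda>F. a * chart_tangent A c p u F + b * chart_tangent A c p w F)"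
proof
  fix F
  have "linear (frechet_derivative (F \<circ> chart_inv c) (at (chart_map c p)))" if "F \<in> smooth_functions A"
    using smooth_function_has_derivative[OF that assms(1), of "chart_map c p"] assms(2) has_derivative_linear by blast
  then show "chart_tangent A c p (a *\<^sub>R u + b *\<^sub>R w) F = a * chart_tangent A c p u F + b * chart_tangent A c p w F"
    by (simp add: chart_tangent_def linear_add linear_cmul)
qed

text \<open>Read through the chart, \<open>\<omega>\<close> is an alternating function of
  coefficient vectors, hence a multiple of \<open>det\<close>, and the coordinate frame has the
  identity as coefficients.\<close>

lemma form_chart_det:
  assumes "alternating_multilinear (tangent_space A p) \<omega>" and c: "c \<in> A" "p \<in> chart_dom c"
  shows "\<omega> (\<lambda>i. chart_tangent A c p (u i)) = det (\<chi> i. u i) * \<omega> (coord_frame A c p)"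
proof -
  let ?T = "chart_tangent A c p"
  have lin: "\<omega> (v(i := (\<lambda>F. a * u F + b * w F))) = a * \<omega> (v(i := u)) + b * \<omega> (v(i := w))"
    if "\<forall>j. v j \<in> tangent_space A p" "u \<in> tangent_space A p" "w \<in> tangent_space A p" for v i a b u w
    using assms(1) that unfolding alternating_multilinear_def by blast
  have alt: "\<omega> v = 0" if "\<forall>j. v j \<in> tangent_space A p" "i \<noteq> j" "v i = v j" for v i j
    using assms(1) that unfolding alternating_multilinear_def by blast
  have upd: "(\<lambda>j. ?T ((u(i := x)) j)) = (\<lambda>j. ?T (u j))(i := ?T x)" for u i x
    by auto
  have "alternating (\<lambda>u. \<omega> (\<lambda>i. ?T (u i)))"
    unfolding alternating_def
  proof (intro conjI allI impI)
    show "\<omega> (\<lambda>j. ?T ((v(i := a *\<^sub>R u + b *\<^sub>R w)) j)) =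
        a * \<omega> (\<lambda>j. ?T ((v(i := u)) j)) + b * \<omega> (\<lambda>j. ?T ((v(i := w)) j))" for v i a b u w
      unfolding upd chart_tangent_linear[OF c] by (rule lin) (auto simp: tangent_space_chart[OF c])
    show "\<omega> (\<lambda>i. ?T (v i)) = 0" if "i \<noteq> j \<and> v i = v j" for v i j
      by (rule alt[of _ i j]) (use that in \<open>auto simp: tangent_space_chart[OF c]\<close>)
  qed
  from alternating_eq_det[OF this, of u] show ?thesis
    by (simp add: coord_frame_def)
qed

text \<open>The matrix of the derivatives of the \<open>F i\<close> along the \<open>u j\<close> is
  the Jacobian times the transpose of the matrix with rows \<open>u j\<close>.\<close>

lemma wedge_chart_det:
  assumes F: "\<forall>i. F i \<in> smooth_functions A" and c: "c \<in> A" "p \<in> chart_dom c"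
  shows "wedge (\<lambda>i. differential (F i)) (\<lambda>i. chart_tangent A c p (u i)) =
    det (jacobian c F (chart_map c p)) * det (\<chi> i. u i)"
proof -
  let ?D = "\<lambda>i. frechet_derivative (F i \<circ> chart_inv c) (at (chart_map c p))"
  have lin: "linear (?D i)" for i
    using smooth_function_has_derivative[OF F[rule_format] c(1), of "chart_map c p"] c(2) has_derivative_linear by blast
  have expand: "?D i v = (\<Sum>k\<in>UNIV. v $ k * ?D i (axis k 1))" for i v
  proof -
    have "?D i (\<Sum>k\<in>UNIV. v $ k *\<^sub>R axis k 1) = (\<Sum>k\<in>UNIV. v $ k * ?D i (axis k 1))"
      by (simp only: linear_sum[OF lin] linear_cmul[OF lin] real_scaleR_def)
    then show ?thesis
      using basis_expansion[of v] by (simp only: scalar_mult_eq_scaleR)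
  qed
  have "(\<Sum>k\<in>UNIV. ?D i (axis k 1) * v $ k) = ?D i v" for i v
    unfolding expand[of i v] by (simp only: mult.commute)
  then have "(\<chi> i j. ?D i (u j)) = jacobian c F (chart_map c p) ** Finite_Cartesian_Product.transpose (\<chi> i. u i)"
    by (simp add: vec_eq_iff matrix_matrix_mult_def jacobian_def Finite_Cartesian_Product.transpose_def)
  then show ?thesis
    using F by (simp add: wedge_def differential_def chart_tangent_def det_mul det_transpose)
qed

end

section \<open>The volume form and the bracket in coordinates\<close>

locale smooth_volume = smooth_atlas M A for M :: "'a::t2_space set" and A :: "('a, 'n::finite) chart set" +
  fixes \<Omega> :: "('a, 'n) top_form"
  assumes volume_form: "volume_form M A \<Omega>"
begin

abbreviation density :: "('a, 'n) chart \<Rightarrow> real ^ 'n \<Rightarrow> real" where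
  "density c x \<equiv> \<Omega> (chart_inv c x) (coord_frame A c (chart_inv c x))"

lemma volume_alternating: "p \<in> M \<Longrightarrow> alternating_multilinear (tangent_space A p) (\<Omega> p)"
  using volume_form by (simp add: volume_form_def smooth_top_form_def)

text \<open>By \<open>form_chart_det\<close>, a top form that vanishes on the coordinate frame
  vanishes on all families of tangent vectors at the point.\<close>

lemma volume_frame_nonzero:
  assumes "c \<in> A" "p \<in> chart_dom c"
  shows "\<Omega> p (coord_frame A c p) \<noteq> 0"
proof -
  have p: "p \<in> M"
    using assms chart_dom_subset by blast
  then obtain v where v: "\<And>i. v i \<in> range (chart_tangent A c p)" "\<Omega> p v \<noteq> 0"
    using volume_form tangent_space_chart[OF assms] unfolding volume_form_def by metis
  then have "\<forall>i. \<exists>u. v i = chart_tangent A c p u"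
    by blast
  then obtain u where "\<And>i. v i = chart_tangent A c p (u i)"
    by metis
  then have "v = (\<lambda>i. chart_tangent A c p (u i))"
    by auto
  then show ?thesis
    using v(2) form_chart_det[OF volume_alternating[OF p] assms] by auto
qed

text \<open>Both sides of the equation defining the bracket are multiples of the determinant of the
  coefficients, so \<open>r\<close> is forced to be the Jacobian determinant over the density, and
  this quotient works. This gives \<open>THE\<close> its value.\<close>

lemma bracket_chart:
  assumes F: "\<forall>i. F i \<in> smooth_functions A" and c: "c \<in> A" "p \<in> chart_dom c"
  shows "bracket A \<Omega> F p * \<Omega> p (coord_frame A c p) = det (jacobian c F (chart_map c p))"
proof -
  have p: "p \<in> M"
    using c chart_dom_subset by blast
  let ?w = "\<Omega> p (coord_frame A c p)" and ?J = "det (jacobian c F (chart_map c p))"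
  have nz: "?w \<noteq> 0"
    by (rule volume_frame_nonzero[OF c])
  have eq: "(\<forall>v. (\<forall>i. v i \<in> tangent_space A p) \<longrightarrow> r * \<Omega> p v = wedge (\<lambda>i. differential (F i)) v) \<longleftrightarrow>
      r = ?J / ?w" for r
  proof
    assume *: "\<forall>v. (\<forall>i. v i \<in> tangent_space A p) \<longrightarrow> r * \<Omega> p v = wedge (\<lambda>i. differential (F i)) v"
    have "r * \<Omega> p (\<lambda>i. chart_tangent A c p (axis i 1)) = ?J * det (\<chi> i. (axis i 1 :: real ^ 'n))"
      using * wedge_chart_det[OF F c, of "\<lambda>i. axis i 1 :: real ^ 'n"] by (simp add: tangent_space_chart[OF c])
    moreover have "(\<chi> i. axis i (1::real)) = (mat 1 :: real ^ 'n ^ 'n)"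
      by (simp add: vec_eq_iff mat_def axis_def)
    ultimately show "r = ?J / ?w"
      using nz by (simp add: coord_frame_def field_simps)
  next
    assume r: "r = ?J / ?w"
    show "\<forall>v. (\<forall>i. v i \<in> tangent_space A p) \<longrightarrow> r * \<Omega> p v = wedge (\<lambda>i. differential (F i)) v"
    proof (intro allI impI)
      fix v :: "'n \<Rightarrow> 'a tangent" assume "\<forall>i. v i \<in> tangent_space A p"
      then have "\<forall>i. \<exists>u. v i = chart_tangent A c p u"
        unfolding tangent_space_chart[OF c] by blast
      then obtain u where "\<And>i. v i = chart_tangent A c p (u i)"
        by metis
      then have v: "v = (\<lambda>i. chart_tangent A c p (u i))"
        by auto
      show "r * \<Omega> p v = wedge (\<lambda>i. differential (F i)) v"
        unfolding v form_chart_det[OF volume_alternating[OF p] c] wedge_chart_det[OF F c] r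
        using nz by simp
    qed
  qed
  have "bracket A \<Omega> F p = ?J / ?w"
    unfolding bracket_def eq by simp
  then show ?thesis
    using nz by simp
qed

lemma bracket_eq_0_iff:
  assumes "\<forall>i. F i \<in> smooth_functions A" "c \<in> A" "p \<in> chart_dom c"
  shows "bracket A \<Omega> F p = 0 \<longleftrightarrow> det (jacobian c F (chart_map c p)) = 0"
  using bracket_chart[OF assms] volume_frame_nonzero[OF assms(2,3)] by auto

end

section \<open>Restricted charts, bump functions and operations on smooth functions\<close>

context smooth_atlas
begin

lemma restricted_chart_inv:
  assumes c: "c \<in> A" and U: "U \<subseteq> chart_dom c" and L: "\<And>x. L' (L x) = x" "\<And>x. L (L' x) = x"
    and y: "y \<in> (L \<circ> chart_map c) ` U"
  shows "chart_inv (U, L \<circ> chart_map c) y = chart_inv c (L' y)"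
proof -
  have "inj_on (L \<circ> chart_map c) U"
    using L U chart_inv_map[OF c] by (intro inj_onI) (metis comp_apply subsetD)
  moreover obtain p where "p \<in> U" "y = L (chart_map c p)"
    using y by auto
  ultimately show ?thesis
    using U chart_inv_map[OF c, of p] L(1) by (auto simp: inv_into_f_eq)
qed

text \<open>Maximality of the atlas reduces membership to compatibility with every chart of
  \<open>A\<close>. The linear isomorphism serves to reverse an orientation, the smaller domain to
  stay where the density keeps its sign.\<close>

lemma restricted_chart:
  assumes c: "c \<in> A" and U: "openin (top_of_set M) U" "U \<subseteq> chart_dom c"
    and L: "bounded_linear L" "bounded_linear L'" "\<And>x. L' (L x) = x" "\<And>x. L (L' x) = x"
  shows "(U, L \<circ> chart_map c) \<in> A"
proof -
  let ?c = "(U, L \<circ> chart_map c)"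
  note inv = restricted_chart_inv[OF c U(2) L(3,4)]
  have L_image: "L ` S = L' -` S" for S
    using L(3,4) by (auto simp: image_iff) metis
  have open_L: "open (L ` S)" if "open S" for S
    unfolding L_image using that L(2) by (simp add: open_vimage linear_continuous_on)
  have open_image: "open ((L \<circ> chart_map c) ` (U \<inter> V))" if "openin (top_of_set M) V" for V
    unfolding image_comp[symmetric]
    using open_L open_chart_image[OF c openin_Int[OF U(1) that]] U(2)
    by (simp add: inf.absorb2 flip: inf.assoc)
  have cont_inv: "continuous_on ((L \<circ> chart_map c) ` U) (chart_inv ?c)"
  proof -
    have "continuous_on ((L \<circ> chart_map c) ` U) (\<lambda>y. chart_inv c (L' y))"
      by (rule continuous_on_compose2[OF continuous_on_chart_inv[OF c] linear_continuous_on[OF L(2)]])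
        (use L(3) U(2) in auto)
    then show ?thesis
      by (rule continuous_on_cong[THEN iffD2, rotated 2]) (use inv in auto)
  qed
  have cont: "continuous_on U (L \<circ> chart_map c)"
    using continuous_on_subset[OF continuous_on_chart_map[OF c] U(2)] linear_continuous_on[OF L(1)]
    by (metis continuous_on_compose continuous_on_subset subset_UNIV)
  have inv_map: "chart_inv ?c (L (chart_map c p)) = p" if "p \<in> U" for p
    using inv[of "L (chart_map c p)"] that U(2) chart_inv_map[OF c] L(3) by auto
  have "is_chart M ?c"
    unfolding is_chart_def
  proof (intro conjI)
    show "open (chart_codom ?c)"
      using open_image[OF openin_topspace] U(1) openin_imp_subset by (fastforce simp: inf.absorb1)
    show "homeomorphism (chart_dom ?c) (chart_codom ?c) (chart_map ?c) (chart_inv ?c)"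
    proof (rule homeomorphismI)
      show "chart_inv ?c ` chart_codom ?c \<subseteq> chart_dom ?c"
        using inv_map by auto
      show "chart_map ?c (chart_inv ?c y) = y" if "y \<in> chart_codom ?c" for y
        using that inv_map by auto
    qed (use cont cont_inv inv_map in auto)
  qed (use U in simp)
  moreover have "smoothly_compatible ?c d" if d: "d \<in> A" for d
    unfolding smoothly_compatible_def
  proof
    let ?S = "(L \<circ> chart_map c) ` (U \<inter> chart_dom d)" and ?S' = "chart_map c ` (chart_dom c \<inter> chart_dom d)"
    have S: "open ?S" "open ?S'"
      by (rule open_image[OF chart_dom_openin[OF d]], rule open_chart_image[OF c chart_dom_openin[OF d]])
    have "smooth_on ?S (\<lambda>y. (chart_map d \<circ> chart_inv c) (L' y))"
      by (rule smooth_on_compose[OF S _ smooth_on_linear[OF S(1) L(2)] smooth_transition[OF c d]])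
        (use L(3) U(2) in auto)
    then show "smooth_on (chart_map ?c ` (chart_dom ?c \<inter> chart_dom d)) (chart_map d \<circ> chart_inv ?c)"
      unfolding fst_conv snd_conv
      by (rule smooth_on_cong[OF S(1), THEN iffD1, rotated]) (use inv in auto)
    let ?T = "chart_map d ` (U \<inter> chart_dom d)"
    have T: "open ?T"
      using open_chart_image[OF d U(1)] by (simp add: inf.commute)
    have "smooth_on ?T (chart_map c \<circ> chart_inv d)"
      by (rule smooth_on_subset[OF smooth_transition[OF d c]]) (use U(2) in auto)
    from smooth_on_bounded_linear[OF T L(1) this]
    show "smooth_on (chart_map d ` (chart_dom ?c \<inter> chart_dom d)) (chart_map ?c \<circ> chart_inv d)"
      by (simp add: o_def)
  qed
  ultimately show ?thesis
    using smooth_structure unfolding smooth_structure_def by blast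
qed

text \<open>The new coordinates are the old ones followed by \<open>L\<close>, so coefficient
  vectors are carried back by the inverse \<open>L'\<close>.\<close>

lemma restricted_chart_tangent:
  assumes c: "c \<in> A" and U: "openin (top_of_set M) U" "U \<subseteq> chart_dom c"
    and L: "bounded_linear L" "bounded_linear L'" "\<And>x. L' (L x) = x" "\<And>x. L (L' x) = x"
    and p: "p \<in> U"
  shows "chart_tangent A (U, L \<circ> chart_map c) p u = chart_tangent A c p (L' u)"
proof
  fix F
  let ?c = "(U, L \<circ> chart_map c)" and ?y = "L (chart_map c p)"
  have cA: "?c \<in> A"
    by (rule restricted_chart[OF c U L])
  have "frechet_derivative (F \<circ> chart_inv ?c) (at ?y) u = frechet_derivative (F \<circ> chart_inv c) (at (chart_map c p)) (L' u)"
    if F: "F \<in> smooth_functions A"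
  proof -
    have "(F \<circ> chart_inv c has_derivative frechet_derivative (F \<circ> chart_inv c) (at (L' ?y))) (at (L' ?y))"
      unfolding L(3) using p U(2) by (intro smooth_function_has_derivative[OF F c]) auto
    then have "((F \<circ> chart_inv c) \<circ> L' has_derivative frechet_derivative (F \<circ> chart_inv c) (at (L' ?y)) \<circ> L') (at ?y)"
      by (rule diff_chain_at[OF bounded_linear_imp_has_derivative[OF L(2)]])
    then have "frechet_derivative ((F \<circ> chart_inv c) \<circ> L') (at ?y) = frechet_derivative (F \<circ> chart_inv c) (at (L' ?y)) \<circ> L'"
      by (rule frechet_derivative_eqI)
    moreover have "frechet_derivative (F \<circ> chart_inv ?c) (at ?y) = frechet_derivative ((F \<circ> chart_inv c) \<circ> L') (at ?y)"
      by (rule frechet_derivative_cong_open[OF open_chart_codom[OF cA]])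
        (use restricted_chart_inv[OF c U(2) L(3,4)] p in auto)
    ultimately show ?thesis
      by (simp add: L(3))
  qed
  then show "chart_tangent A ?c p u F = chart_tangent A c p (L' u) F"
    by (simp add: chart_tangent_def)
qed

text \<open>\<open>flat 0\<close> of r^2 - |y - x|^2 is positive exactly on a ball whose closure
  lies in the chart image; it is pulled back and extended by 0. Smoothness is checked on the chart
  domain and on the complement of the compact \<open>K\<close>, two open sets that cover
  \<open>M\<close>.\<close>

lemma smooth_bump:
  assumes c: "c \<in> A" "p \<in> chart_dom c"
  shows "\<exists>b K. b \<in> smooth_functions A \<and> (\<forall>q. 0 \<le> b q) \<and> b p > 0 \<and>
    openin (top_of_set M) {q \<in> M. b q > 0} \<and>
    compact K \<and> K \<subseteq> chart_dom c \<and> (\<forall>q\<in>M - K. b q = 0)"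
proof -
  let ?x = "chart_map c p"
  obtain r where r: "r > 0" "cball ?x r \<subseteq> chart_codom c"
    using open_chart_codom[OF c(1)] c(2) by (meson image_eqI open_contains_cball)
  define \<phi> where "\<phi> y = flat 0 (r\<^sup>2 - (y - ?x) \<bullet> (y - ?x))" for y
  have \<phi>: "smooth_on UNIV \<phi>"
  proof -
    have "smooth_on UNIV (\<lambda>y. y - ?x)"
      by (intro smooth_on_diff smooth_on_id smooth_on_const open_UNIV)
    then have "smooth_on UNIV (\<lambda>y. (y - ?x) \<bullet> (y - ?x))"
      by (rule smooth_on_bilinear[OF open_UNIV bounded_bilinear_inner]) fact
    then show ?thesis
      unfolding \<phi>_def by (intro smooth_on_flat_compose smooth_on_diff smooth_on_const open_UNIV)
  qed
  have \<phi>_pos: "\<phi> y > 0 \<longleftrightarrow> y \<in> ball ?x r" for y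
  proof -
    have "(y - ?x) \<bullet> (y - ?x) = (dist ?x y)\<^sup>2"
      by (simp add: dot_square_norm dist_norm norm_minus_commute)
    then have "\<phi> y > 0 \<longleftrightarrow> (dist ?x y)\<^sup>2 < r\<^sup>2"
      by (simp add: \<phi>_def flat_pos_iff)
    also have "\<dots> \<longleftrightarrow> dist ?x y < r"
      using r(1) power_mono_iff[of r "dist ?x y" 2] by (simp flip: not_le)
    finally show ?thesis by simp
  qed
  define b where "b q = (if q \<in> chart_dom c then \<phi> (chart_map c q) else 0)" for q
  define K where "K = chart_inv c ` cball ?x r"
  have K: "compact K"
    unfolding K_def by (rule compact_continuous_image[OF continuous_on_subset[OF continuous_on_chart_inv[OF c(1)] r(2)]]) simp
  have K_dom: "K \<subseteq> chart_dom c"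
    unfolding K_def using r(2) by (blast intro: chart_inv_in_dom)
  have b_0: "b q = 0" if "q \<notin> K" for q
  proof (cases "q \<in> chart_dom c")
    case True
    have "chart_map c q \<notin> ball ?x r"
    proof
      assume "chart_map c q \<in> ball ?x r"
      then have "chart_inv c (chart_map c q) \<in> K"
        by (simp add: K_def)
      then show False
        using that chart_inv_map[OF c(1) True] by simp
    qed
    moreover have "\<phi> (chart_map c q) \<ge> 0"
      by (simp add: \<phi>_def flat_nonneg)
    ultimately show ?thesis
      using \<phi>_pos[of "chart_map c q"] by (simp add: b_def)
  qed (simp add: b_def)
  have "smooth_on (chart_codom d) (b \<circ> chart_inv d)" if d: "d \<in> A" for d
  proof (rule smooth_on_local)
    fix y assume y: "y \<in> chart_codom d"
    show "\<exists>S. open S \<and> y \<in> S \<and> smooth_on S (b \<circ> chart_inv d)"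
    proof (cases "chart_inv d y \<in> chart_dom c")
      case True
      let ?S = "chart_map d ` (chart_dom d \<inter> chart_dom c)"
      have S: "open ?S"
        by (rule open_chart_image[OF d chart_dom_openin[OF c(1)]])
      have "smooth_on ?S (\<lambda>z. \<phi> ((chart_map c \<circ> chart_inv d) z))"
        by (rule smooth_on_compose[OF S open_UNIV _ smooth_transition[OF d c(1)] \<phi>]) auto
      then have "smooth_on ?S (b \<circ> chart_inv d)"
        by (rule smooth_on_cong[OF S, THEN iffD1, rotated]) (auto simp: b_def chart_inv_map[OF d])
      moreover have "y \<in> ?S"
        using True y chart_inv_in_dom[OF y] chart_map_inv[OF y] by (metis IntI image_eqI)
      ultimately show ?thesis
        using S by blast
    next
      case False
      let ?S = "chart_map d ` (chart_dom d \<inter> (M - K))"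
      \<comment> \<open>Compact sets are closed because the ambient space is Hausdorff.\<close>
      have "openin (top_of_set M) (M - K)"
        using compact_imp_closed[OF K] by (simp add: Diff_eq open_Compl openin_open_Int)
      then have S: "open ?S"
        by (rule open_chart_image[OF d])
      have "smooth_on ?S (b \<circ> chart_inv d)"
        by (rule smooth_on_cong[OF S, THEN iffD1, OF _ smooth_on_const[of _ 0]])
          (auto simp: b_0 chart_inv_map[OF d])
      moreover have "y \<in> ?S"
      proof (rule image_eqI)
        show "y = chart_map d (chart_inv d y)"
          by (rule chart_map_inv[OF y, symmetric])
        show "chart_inv d y \<in> chart_dom d \<inter> (M - K)"
          using False K_dom chart_inv_in_dom[OF y] chart_dom_subset[OF d] by blast
      qed
      ultimately show ?thesis
        using S by blast
    qed
  qed
  then have "b \<in> smooth_functions A"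
    by (simp add: smooth_functions_def)
  moreover have "b q \<ge> 0" for q
    by (simp add: b_def \<phi>_def flat_nonneg)
  moreover have "b p > 0"
    using c(2) r(1) by (simp add: b_def \<phi>_pos)
  moreover have pos: "{q \<in> M. b q > 0} = {q \<in> chart_dom c. chart_map c q \<in> ball ?x r}"
    using chart_dom_subset[OF c(1)] by (auto simp: b_def \<phi>_pos)
  have "openin (top_of_set M) {q \<in> M. b q > 0}"
    unfolding pos by (rule openin_chart_preimage[OF c(1) open_ball])
  moreover have "\<forall>q\<in>M - K. b q = 0"
    using b_0 by blast
  ultimately show ?thesis
    using K K_dom by (intro exI[of _ b] exI[of _ K] conjI allI)
qed

lemma smooth_functions_sum:
  "(\<And>i. i \<in> I \<Longrightarrow> f i \<in> smooth_functions A) \<Longrightarrow> (\<lambda>p. \<Sum>i\<in>I. f i p) \<in> smooth_functions A"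
  unfolding smooth_functions_def o_def mem_Collect_eq
proof
  fix c assume *: "\<And>i. i \<in> I \<Longrightarrow> \<forall>c\<in>A. smooth_on (chart_codom c) (\<lambda>x. f i (chart_inv c x))" and "c \<in> A"
  then show "smooth_on (chart_codom c) (\<lambda>x. \<Sum>i\<in>I. f i (chart_inv c x))"
    by (intro smooth_on_sum[OF open_chart_codom[OF \<open>c \<in> A\<close>], of I "\<lambda>i x. f i (chart_inv c x)"]) blast
qed

lemma smooth_functions_divide:
  assumes "f \<in> smooth_functions A" "g \<in> smooth_functions A" "\<And>p. p \<in> M \<Longrightarrow> g p \<noteq> 0"
  shows "(\<lambda>p. f p / g p) \<in> smooth_functions A"
  unfolding smooth_functions_def o_def mem_Collect_eq
proof
  fix c assume c: "c \<in> A"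
  have "g (chart_inv c x) \<noteq> 0" if "x \<in> chart_codom c" for x
    using assms(3) chart_inv_in_dom[OF that] chart_dom_subset[OF c] by blast
  then show "smooth_on (chart_codom c) (\<lambda>x. f (chart_inv c x) / g (chart_inv c x))"
    using smooth_on_divide[OF open_chart_codom[OF c]] smooth_functionsD[OF assms(1) c]
      smooth_functionsD[OF assms(2) c] by (simp add: o_def)
qed

end

section \<open>Oriented charts, partitions of unity and the norm in coordinates\<close>

context smooth_volume
begin

lemma oriented_chart_at:
  assumes "p \<in> M"
  shows "\<exists>c. oriented_chart A \<Omega> c \<and> p \<in> chart_dom c"
proof -
  obtain c where c: "c \<in> A" "p \<in> chart_dom c"
    using chart_cover[OF assms] by blast
  define s where "s = sgn (density c (chart_map c p))"
  have s: "s * s = 1" "s * density c (chart_map c p) > 0"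
    using volume_frame_nonzero[OF c] by (auto simp: s_def chart_inv_map[OF c] sgn_if)
  obtain k :: 'n where True by simp
  \<comment> \<open>Reflecting one coordinate if \<open>s = -1\<close> makes the chart positively oriented near \<open>p\<close>.\<close>
  define L :: "real ^ 'n \<Rightarrow> real ^ 'n" where "L x = (\<chi> i. if i = k then s * x $ i else x $ i)" for x
  have L: "bounded_linear L" "\<And>x. L (L x) = x"
  proof -
    show "bounded_linear L"
      unfolding linear_conv_bounded_linear[symmetric]
      by (rule linearI) (simp_all add: L_def vec_eq_iff algebra_simps)
    show "L (L x) = x" for x
      using s(1) by (simp add: L_def vec_eq_iff flip: mult.assoc)
  qed
  have "smooth_on (chart_codom c) (density c)"
    using volume_form c(1) by (simp add: volume_form_def smooth_top_form_def)
  then have cont: "continuous_on (chart_codom c) (\<lambda>x. s * density c x)"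
    by (intro continuous_intros smooth_on_continuous)
  \<comment> \<open>The sign \<open>s\<close> is read off at \<open>p\<close> only, so the chart is
    cut down to the open set where the density keeps it.\<close>
  define V where "V = {x \<in> chart_codom c. s * density c x > 0}"
  have "open (chart_codom c \<inter> (\<lambda>x. s * density c x) -` {0<..})"
    by (rule continuous_open_preimage[OF cont open_chart_codom[OF c(1)] open_greaterThan])
  also have "chart_codom c \<inter> (\<lambda>x. s * density c x) -` {0<..} = V"
    unfolding V_def by blast
  finally have "open V" .
  define U where "U = {q \<in> chart_dom c. chart_map c q \<in> V}"
  have U: "openin (top_of_set M) U" "U \<subseteq> chart_dom c" "p \<in> U"
    using openin_chart_preimage[OF c(1) \<open>open V\<close>] c s(2) by (auto simp: U_def V_def)
  let ?c = "(U, L \<circ> chart_map c)"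
  have "\<Omega> q (coord_frame A ?c q) > 0" if q: "q \<in> U" for q
  proof -
    have qc: "q \<in> chart_dom c" and qM: "q \<in> M"
      using q U(2) chart_dom_subset[OF c(1)] by auto
    have "coord_frame A ?c q = (\<lambda>i. chart_tangent A c q (L (axis i 1)))"
      by (simp add: coord_frame_def restricted_chart_tangent[OF c(1) U(1,2) L(1,1,2,2) q])
    then have "\<Omega> q (coord_frame A ?c q) = det (\<chi> i. L (axis i 1)) * \<Omega> q (coord_frame A c q)"
      using form_chart_det[OF volume_alternating[OF qM] c(1) qc] by simp
    also have "det (\<chi> i. L (axis i 1)) = (\<Prod>i\<in>UNIV. if i = k then s else 1)"
    proof (subst det_diagonal)
      show "(\<Prod>i\<in>UNIV. (\<chi> i. L (axis i 1)) $ i $ i) = (\<Prod>i\<in>UNIV. if i = k then s else 1)"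
        by (rule prod.cong) (simp_all add: L_def)
    qed (simp add: L_def axis_def)
    also have "\<dots> = s"
      by simp
    also have "s * \<Omega> q (coord_frame A c q) = s * density c (chart_map c q)"
      by (simp add: chart_inv_map[OF c(1) qc])
    also have "\<dots> > 0"
      using q by (simp add: U_def V_def)
    finally show ?thesis .
  qed
  then have "oriented_chart A \<Omega> ?c"
    using restricted_chart[OF c(1) U(1,2) L(1,1,2,2)] by (simp add: oriented_chart_def)
  then show ?thesis
    using U(3) by auto
qed

text \<open>Compactness selects finitely many bumps whose positivity sets cover \<open>M\<close>;
  their sum \<open>B\<close> is then positive on \<open>M\<close> and can be divided by.\<close>

lemma oriented_partition_exists:
  assumes "compact M"
  shows "\<exists>C \<rho>. oriented_partition M A \<Omega> C \<rho>"
proof -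
  define good where "good p c b K \<longleftrightarrow> oriented_chart A \<Omega> c \<and> b \<in> smooth_functions A \<and> (\<forall>q. 0 \<le> b q) \<and> b p > 0 \<and>
      openin (top_of_set M) {q \<in> M. b q > 0} \<and> compact K \<and> K \<subseteq> chart_dom c \<and> (\<forall>q\<in>M - K. b q = 0)"
    for p and c :: "('a, 'n) chart" and b :: "'a \<Rightarrow> real" and K :: "'a set"
  have "\<exists>c b K. good p c b K" if "p \<in> M" for p
  proof -
    obtain c where c: "oriented_chart A \<Omega> c" "p \<in> chart_dom c"
      using oriented_chart_at[OF \<open>p \<in> M\<close>] by blast
    then have "c \<in> A"
      by (simp add: oriented_chart_def)
    from smooth_bump[OF this c(2)] c(1) show ?thesis
      unfolding good_def by blast
  qed
  then obtain c b K where good: "\<And>p. p \<in> M \<Longrightarrow> good p (c p) (b p) (K p)"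
    by metis
  have c: "oriented_chart A \<Omega> (c p)"
    and b: "b p \<in> smooth_functions A" "0 \<le> b p q" "b p p > 0" "openin (top_of_set M) {q \<in> M. b p q > 0}"
    and K: "compact (K p)" "K p \<subseteq> chart_dom (c p)" "q \<in> M - K p \<Longrightarrow> b p q = 0"
    if "p \<in> M" for p q
    using good[OF that] unfolding good_def by blast+
  have "\<exists>D. D \<subseteq> (\<lambda>p. {q \<in> M. b p q > 0}) ` M \<and> finite D \<and> M \<subseteq> \<Union>D"
  proof -
    have cover: "M \<subseteq> \<Union> ((\<lambda>p. {q \<in> M. b p q > 0}) ` M)"
      using b(3) by auto
    have op: "\<forall>T\<in>(\<lambda>p. {q \<in> M. b p q > 0}) ` M. openin (top_of_set M) T"
      using b(4) by auto
    show ?thesis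
      using assms op cover unfolding compact_eq_openin_cover by blast
  qed
  then obtain D' where D': "D' \<subseteq> (\<lambda>p. {q \<in> M. b p q > 0}) ` M" "finite D'" "M \<subseteq> \<Union>D'"
    by blast
  then obtain D where D: "D \<subseteq> M" "finite D" "D' = (\<lambda>p. {q \<in> M. b p q > 0}) ` D"
    using finite_subset_image[OF D'(2,1)] by blast
  define B where "B q = (\<Sum>p\<in>D. b p q)" for q
  have B_pos: "B q > 0" if "q \<in> M" for q
  proof -
    obtain p where "p \<in> D" "b p q > 0"
      using D(3) D'(3) \<open>q \<in> M\<close> by blast
    then show ?thesis
      unfolding B_def using D b(2) by (intro sum_pos2[of D p]) auto
  qed
  \<comment> \<open>A partition is indexed by charts and \<open>c\<close> may be non-injective, so
    bumps that share a chart are added.\<close>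
  define \<rho> where "\<rho> d q = (\<Sum>p | p \<in> D \<and> c p = d. b p q) / B q" for d q
  have "oriented_partition M A \<Omega> (c ` D) \<rho>"
    unfolding oriented_partition_def
  proof (intro conjI ballI)
    show "finite (c ` D)"
      using D(2) by simp
    fix d assume d: "d \<in> c ` D"
    show "oriented_chart A \<Omega> d"
      using d c D(1) by auto
    have "B \<in> smooth_functions A"
      unfolding B_def using D(1) b(1) by (intro smooth_functions_sum) auto
    then have "(\<lambda>q. (\<Sum>p | p \<in> D \<and> c p = d. b p q) / B q) \<in> smooth_functions A"
      using B_pos D(1) b(1) by (intro smooth_functions_divide smooth_functions_sum) force+
    then show "\<rho> d \<in> smooth_functions A"
      by (simp add: \<rho>_def[abs_def])
    show "0 \<le> \<rho> d q" if "q \<in> M" for q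
      unfolding \<rho>_def using B_pos[OF that] b(2) D(1) by (intro divide_nonneg_pos sum_nonneg) auto
    show "\<exists>K. compact K \<and> K \<subseteq> chart_dom d \<and> (\<forall>p\<in>M - K. \<rho> d p = 0)"
    proof (intro exI conjI ballI)
      let ?K = "\<Union>p\<in>{p \<in> D. c p = d}. K p"
      show "compact ?K"
        using D K(1) by (intro compact_UN) auto
      show "?K \<subseteq> chart_dom d"
        using D(1) K(2) by blast
      show "\<rho> d q = 0" if "q \<in> M - ?K" for q
        unfolding \<rho>_def using that D(1) K(3) by (subst sum.neutral) auto
    qed
  next
    fix q assume q: "q \<in> M"
    have "(\<Sum>d\<in>c ` D. \<rho> d q) = (\<Sum>d\<in>c ` D. \<Sum>p | p \<in> D \<and> c p = d. b p q) / B q"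
      by (simp add: \<rho>_def sum_divide_distrib)
    also have "(\<Sum>d\<in>c ` D. \<Sum>p | p \<in> D \<and> c p = d. b p q) = B q"
      unfolding B_def by (rule sum.image_gen[OF D(2), symmetric])
    finally show "(\<Sum>d\<in>c ` D. \<rho> d q) = 1"
      using B_pos[OF q] by simp
  qed
  then show ?thesis by blast
qed

text \<open>The choice in \<open>form_integral\<close> is resolved to the sum for some partition. In
  its oriented charts the density is positive, can be moved into the absolute value, and turns the
  bracket into the Jacobian determinant.\<close>

lemma L1_norm_bracket:
  assumes "compact M" and F: "\<forall>i. F i \<in> smooth_functions A"
  shows "\<exists>C \<rho>. oriented_partition M A \<Omega> C \<rho> \<and>
    L1_norm M A \<Omega> (bracket A \<Omega> F) =
      (\<Sum>c\<in>C. integral (chart_codom c) (\<lambda>x. \<rho> c (chart_inv c x) * \<bar>det (jacobian c F x)\<bar>))"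
proof -
  have "\<exists>I. has_form_integral M A \<Omega> (\<lambda>p v. \<bar>bracket A \<Omega> F p\<bar> * \<Omega> p v) I"
    using oriented_partition_exists[OF assms(1)] by (auto simp: has_form_integral_def)
  then have "has_form_integral M A \<Omega> (\<lambda>p v. \<bar>bracket A \<Omega> F p\<bar> * \<Omega> p v) (L1_norm M A \<Omega> (bracket A \<Omega> F))"
    unfolding L1_norm_def form_integral_def by (rule someI_ex)
  then obtain C \<rho> where C: "oriented_partition M A \<Omega> C \<rho>"
    and I: "L1_norm M A \<Omega> (bracket A \<Omega> F) = (\<Sum>c\<in>C. integral (chart_codom c)
      (\<lambda>x. \<rho> c (chart_inv c x) * (\<bar>bracket A \<Omega> F (chart_inv c x)\<bar> * density c x)))"
    unfolding has_form_integral_def by blast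
  have "\<bar>bracket A \<Omega> F (chart_inv c x)\<bar> * density c x = \<bar>det (jacobian c F x)\<bar>"
    if "c \<in> C" "x \<in> chart_codom c" for c x
  proof -
    have c: "c \<in> A" "\<And>p. p \<in> chart_dom c \<Longrightarrow> \<Omega> p (coord_frame A c p) > 0"
      using C that(1) by (auto simp: oriented_partition_def oriented_chart_def)
    have p: "chart_inv c x \<in> chart_dom c"
      by (rule chart_inv_in_dom[OF that(2)])
    have "\<bar>bracket A \<Omega> F (chart_inv c x)\<bar> * density c x = \<bar>bracket A \<Omega> F (chart_inv c x) * density c x\<bar>"
      using c(2)[OF p] by (simp add: abs_mult)
    also have "\<dots> = \<bar>det (jacobian c F x)\<bar>"
      using bracket_chart[OF F c(1) p] by (simp add: chart_map_inv[OF that(2)])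
    finally show ?thesis .
  qed
  then have "L1_norm M A \<Omega> (bracket A \<Omega> F) =
      (\<Sum>c\<in>C. integral (chart_codom c) (\<lambda>x. \<rho> c (chart_inv c x) * \<bar>det (jacobian c F x)\<bar>))"
    unfolding I by (intro sum.cong integral_cong) auto
  then show ?thesis
    using C by blast
qed

end

section \<open>The volume of the image is bounded by the integral\<close>

lemma borel_level_set:
  fixes f :: "'a::topological_space \<Rightarrow> 'b::topological_space"
  assumes "open U" "continuous_on U f" "B \<in> sets borel"
  shows "{x \<in> U. f x \<in> B} \<in> sets borel"
proof -
  have "f -` B \<inter> space (restrict_space borel U) \<in> sets (restrict_space borel U)"
    by (rule measurable_sets[OF borel_measurable_continuous_on_restrict[OF assms(2)] assms(3)])
  moreover have "f -` B \<inter> space (restrict_space borel U) = {x \<in> U. f x \<in> B}"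
    by (auto simp: space_restrict_space)
  ultimately show ?thesis
    using assms(1) by (simp add: sets_restrict_space_iff)
qed

context smooth_volume
begin

lemma continuous_on_jacobian_det:
  assumes "\<forall>i. F i \<in> smooth_functions A" "c \<in> A"
  shows "continuous_on (chart_codom c) (\<lambda>x. \<bar>det (jacobian c F x)\<bar>)"
proof -
  have "continuous_on (chart_codom c) (\<lambda>x. jacobian c F x $ i $ j)" for i j
    using smooth_on_continuous_derivative[OF smooth_functionsD[OF assms(1)[rule_format] assms(2)]]
    by (simp add: jacobian_def)
  then show ?thesis
    unfolding det_def
    by (intro continuous_on_rabs continuous_on_sum continuous_on_mult continuous_on_const continuous_on_prod)
qed

lemma has_derivative_jacobian:
  assumes "\<forall>i. F i \<in> smooth_functions A" "c \<in> A" "x \<in> chart_codom c"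
  shows "((\<lambda>x. \<chi> i. F i (chart_inv c x)) has_derivative
    (\<lambda>u. \<chi> i. frechet_derivative (F i \<circ> chart_inv c) (at x) u)) (at x)"
proof -
  have "((\<lambda>x. F i (chart_inv c x)) has_derivative frechet_derivative (F i \<circ> chart_inv c) (at x)) (at x)" for i
    using smooth_function_has_derivative[OF assms(1)[rule_format] assms(2,3)] by (simp add: o_def)
  then show ?thesis
    by (subst has_derivative_componentwise_within) (auto simp: Basis_vec_def inner_axis)
qed

lemma matrix_jacobian:
  "matrix (\<lambda>u. \<chi> i. frechet_derivative (F i \<circ> chart_inv c) (at x) u) = jacobian c F x"
  by (simp add: matrix_def jacobian_def)

text \<open>The determinant may be unbounded near the edge of the chart image, but the weight
  confines the integrand to the compact \<open>Q\<close>, on which it is continuous.\<close>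

lemma weight_integrable:
  assumes "oriented_partition M A \<Omega> C \<rho>" "c \<in> C" and F: "\<forall>i. F i \<in> smooth_functions A"
  shows "set_integrable lborel (chart_codom c) (\<lambda>x. \<rho> c (chart_inv c x) * \<bar>det (jacobian c F x)\<bar>)"
proof -
  let ?w = "\<lambda>x. \<rho> c (chart_inv c x) * \<bar>det (jacobian c F x)\<bar>"
  have c: "c \<in> A" "\<rho> c \<in> smooth_functions A"
    and "\<exists>K. compact K \<and> K \<subseteq> chart_dom c \<and> (\<forall>p\<in>M - K. \<rho> c p = 0)"
    using assms(1,2) by (auto simp: oriented_partition_def oriented_chart_def)
  then obtain K where K: "compact K" "K \<subseteq> chart_dom c" "\<And>p. p \<in> M - K \<Longrightarrow> \<rho> c p = 0"
    by blast
  define Q where "Q = chart_map c ` K"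
  have Q: "compact Q" "Q \<subseteq> chart_codom c"
    using K(2) compact_continuous_image[OF continuous_on_subset[OF continuous_on_chart_map[OF c(1)] K(2)] K(1)]
    by (auto simp: Q_def)
  have "continuous_on (chart_codom c) ?w"
    using smooth_on_continuous[OF smooth_functionsD[OF c(2,1)]]
    by (intro continuous_on_mult continuous_on_jacobian_det[OF F c(1)]) (simp add: o_def)
  then have "integrable lborel (\<lambda>x. indicator Q x *\<^sub>R ?w x)"
    using Q by (intro borel_integrable_compact) (auto intro: continuous_on_subset)
  moreover have "?w x = 0" if "x \<in> chart_codom c" "x \<notin> Q" for x
  proof -
    have "chart_inv c x \<notin> K"
      using that(2) chart_map_inv[OF that(1)] by (force simp: Q_def)
    then show ?thesis
      using K(3) chart_inv_in_dom[OF that(1)] chart_dom_subset[OF c(1)] by auto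
  qed
  then have "(\<lambda>x. indicator Q x *\<^sub>R ?w x) = (\<lambda>x. indicator (chart_codom c) x *\<^sub>R ?w x)"
    using Q(2) by (fastforce simp: indicator_def fun_eq_iff)
  ultimately show ?thesis
    by (simp add: set_integrable_def)
qed

text \<open>Where the weight is at least \<open>m\<close>, the determinant is dominated by the
  weighted integrand over \<open>m\<close> and so is integrable on \<open>S\<close>. The area
  inequality applies to the unweighted determinant, and multiplication by \<open>m\<close> returns
  to the weighted one.\<close>

lemma weighted_image_measure:
  assumes "oriented_partition M A \<Omega> C \<rho>" "c \<in> C" and F: "\<forall>i. F i \<in> smooth_functions A"
    and S: "S \<in> sets borel" "S \<subseteq> chart_codom c" and m: "m > 0" "\<And>x. x \<in> S \<Longrightarrow> m \<le> \<rho> c (chart_inv c x)"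
  shows "(\<lambda>x. \<chi> i. F i (chart_inv c x)) ` S \<in> lmeasurable"
    and "m * measure lebesgue ((\<lambda>x. \<chi> i. F i (chart_inv c x)) ` S) \<le>
      integral S (\<lambda>x. \<rho> c (chart_inv c x) * \<bar>det (jacobian c F x)\<bar>)"
proof -
  let ?w = "\<lambda>x. \<rho> c (chart_inv c x) * \<bar>det (jacobian c F x)\<bar>" and ?g = "\<lambda>x. \<bar>det (jacobian c F x)\<bar>"
  let ?f = "\<lambda>x. \<chi> i. F i (chart_inv c x)"
  have c: "c \<in> A"
    using assms(1,2) by (auto simp: oriented_partition_def oriented_chart_def)
  have w: "set_integrable lborel S ?w"
    using set_integrable_subset[OF weight_integrable[OF assms(1,2) F]] S by simp
  have "set_integrable lborel S ?g"
  proof (rule set_integrable_bound[OF set_integrable_mult_right[of "1 / m", OF w]])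
    show "set_borel_measurable lborel S ?g"
    proof -
      have "?g \<in> borel_measurable (restrict_space borel S)"
        by (rule borel_measurable_continuous_on_restrict[OF continuous_on_subset[OF continuous_on_jacobian_det[OF F c] S(2)]])
      then show ?thesis
        using S(1) by (simp add: set_borel_measurable_def borel_measurable_restrict_space_iff)
    qed
    show "AE x in lborel. x \<in> S \<longrightarrow> norm (?g x) \<le> norm (1 / m * ?w x)"
    proof (intro AE_I2 impI)
      fix x assume "x \<in> S"
      then have "m * ?g x \<le> ?w x"
        by (intro mult_right_mono m) auto
      then have "?g x \<le> 1 / m * ?w x"
        using m(1) by (simp add: field_simps)
      also have "\<dots> \<le> norm (1 / m * ?w x)"
        by (simp only: real_norm_def abs_ge_self)
      finally show "norm (?g x) \<le> norm (1 / m * ?w x)"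
        by simp
    qed
  qed
  then have g: "?g integrable_on S"
    by (rule set_borel_integral_eq_integral)
  have deriv: "(?f has_derivative (\<lambda>u. \<chi> i. frechet_derivative (F i \<circ> chart_inv c) (at x) u)) (at x within S)"
    if "x \<in> S" for x
    using has_derivative_jacobian[OF F c] that S(2) has_derivative_at_withinI by blast
  note image = measure_differentiable_image_finite[OF S(1) deriv, unfolded matrix_jacobian, OF _ g]
  show "?f ` S \<in> lmeasurable"
    by (rule image(1))
  have "m * measure lebesgue (?f ` S) \<le> m * integral S ?g"
    using image(2) m(1) by (intro mult_left_mono) auto
  also have "\<dots> = integral S (\<lambda>x. m * ?g x)"
    by simp
  also have "\<dots> \<le> integral S ?w"
    using g m(2) set_borel_integral_eq_integral(1)[OF w]
    by (intro integral_le integrable_on_mult_right mult_right_mono) auto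
  finally show "m * measure lebesgue (?f ` S) \<le> integral S ?w" .
qed

text \<open>
  \<open>M\<close> is cut into the level sets of \<open>p \<mapsto> (\<lfloor>N * \<rho> c p\<rfloor>)\<^sub>c\<close>, on which all weights are constant
  up to \<open>1 / N\<close>; summing over the charts recovers the total weight \<open>1\<close> up to \<open>card C / N\<close>.
\<close>

lemma measure_image_le_approx:
  assumes part: "oriented_partition M A \<Omega> C \<rho>" and F: "\<forall>i. F i \<in> smooth_functions A"
    and N: "N > card C"
  shows "(\<lambda>p. \<chi> i. F i p) ` M \<in> lmeasurable"
    and "(1 - card C / N) * measure lebesgue ((\<lambda>p. \<chi> i. F i p) ` M) \<le>
      (\<Sum>c\<in>C. integral (chart_codom c) (\<lambda>x. \<rho> c (chart_inv c x) * \<bar>det (jacobian c F x)\<bar>))"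
proof -
  let ?w = "\<lambda>c x. \<rho> c (chart_inv c x) * \<bar>det (jacobian c F x)\<bar>" and ?f = "\<lambda>p. \<chi> i. F i p"
  let ?\<mu> = "measure lebesgue"
  have fin: "finite C" and C: "\<And>c. c \<in> C \<Longrightarrow> c \<in> A" "\<And>c. c \<in> C \<Longrightarrow> \<rho> c \<in> smooth_functions A"
    and nonneg: "\<And>c p. c \<in> C \<Longrightarrow> p \<in> M \<Longrightarrow> 0 \<le> \<rho> c p"
    and sum: "\<And>p. p \<in> M \<Longrightarrow> (\<Sum>c\<in>C. \<rho> c p) = 1"
    and supp: "\<And>c p. c \<in> C \<Longrightarrow> p \<in> M \<Longrightarrow> \<rho> c p \<noteq> 0 \<Longrightarrow> p \<in> chart_dom c"
    using part unfolding oriented_partition_def oriented_chart_def by blast+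
  have inM: "chart_inv c x \<in> M" if "c \<in> C" "x \<in> chart_codom c" for c x
    using chart_inv_in_dom[OF that(2)] chart_dom_subset[OF C(1)[OF that(1)]] by (rule rev_subsetD)
  have N0: "real N > 0"
    using N by simp
  \<comment> \<open>Each weight is recorded in units of 1 / N, rounded down. The restriction to
    \<open>C\<close> makes \<open>\<kappa> p\<close> extensional, so that its values lie in the
    finite set \<open>T\<close>.\<close>
  define \<kappa> where "\<kappa> p = (\<lambda>c\<in>C. \<lfloor>N * \<rho> c p\<rfloor>)" for p
  define T where "T = (C \<rightarrow>\<^sub>E {0..int N})"
  have T: "finite T"
    unfolding T_def using fin by (intro finite_PiE) auto
  have \<kappa>_T: "\<kappa> p \<in> T" if "p \<in> M" for p
  proof -
    have "\<lfloor>N * \<rho> c p\<rfloor> \<in> {0..int N}" if "c \<in> C" for c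
    proof -
      have "\<rho> c p \<le> 1"
        using member_le_sum[of c C "\<lambda>c. \<rho> c p"] nonneg \<open>p \<in> M\<close> that fin sum by auto
      then have "N * \<rho> c p \<le> N"
        using N0 by (simp add: mult_left_le)
      then have "\<lfloor>N * \<rho> c p\<rfloor> \<le> int N"
        by linarith
      then show ?thesis
        using nonneg[OF that \<open>p \<in> M\<close>] by simp
    qed
    then show ?thesis
      by (simp add: \<kappa>_def T_def)
  qed
  define E where "E k = {p \<in> M. \<kappa> p = k}" for k
  define S where "S c k = {x \<in> chart_codom c. \<kappa> (chart_inv c x) = k}" for c :: "('a, 'n) chart" and k
  have S_borel: "S d k \<in> sets borel" if d: "d \<in> C" for d k
  proof (cases "k \<in> extensional C")
    case True
    have "S d k = (chart_codom d) \<inter> (\<Inter>c\<in>C. {x \<in> chart_codom d. (\<rho> c \<circ> chart_inv d) x \<in> {k c / N..<(k c + 1) / N}})"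
    proof -
      have "\<kappa> p = k \<longleftrightarrow> (\<forall>c\<in>C. \<rho> c p \<in> {k c / N..<(k c + 1) / N})" for p
      proof -
        have "\<kappa> p = k \<longleftrightarrow> (\<forall>c\<in>C. \<lfloor>N * \<rho> c p\<rfloor> = k c)"
          using True by (auto simp: \<kappa>_def fun_eq_iff extensional_def restrict_def)
        also have "\<dots> \<longleftrightarrow> (\<forall>c\<in>C. \<rho> c p \<in> {k c / N..<(k c + 1) / N})"
          using N0 by (intro ball_cong) (auto simp: floor_eq_iff field_simps)
        finally show ?thesis .
      qed
      then show ?thesis
        by (auto simp: S_def)
    qed
    moreover have "{x \<in> chart_codom d. (\<rho> c \<circ> chart_inv d) x \<in> {k c / N..<(k c + 1) / N}} \<in> sets borel"
      if "c \<in> C" for c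
      by (rule borel_level_set[OF open_chart_codom[OF C(1)[OF d]]
            smooth_on_continuous[OF smooth_functionsD[OF C(2)[OF that] C(1)[OF d]]]]) simp
    ultimately show ?thesis
      using fin open_chart_codom[OF C(1)[OF d]]
      by (cases "C = {}") (auto intro!: sets.Int sets.finite_INT)
  next
    case False
    then have "S d k = {}"
      by (auto simp: S_def \<kappa>_def)
    then show ?thesis by simp
  qed
  have w_int: "?w c integrable_on S c k" and w_nonneg: "0 \<le> integral (S c k) (?w c)" if "c \<in> C" for c k
  proof -
    have "set_integrable lborel (S c k) (?w c)"
      by (rule set_integrable_subset[OF weight_integrable[OF part that F]])
        (use S_borel[OF that] in \<open>auto simp: S_def\<close>)
    then show "?w c integrable_on S c k"
      by (rule set_borel_integral_eq_integral)
    then show "0 \<le> integral (S c k) (?w c)"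
    proof (rule integral_nonneg)
      fix x assume "x \<in> S c k"
      then have "chart_inv c x \<in> M"
        using inM[OF that] by (auto simp: S_def)
      then show "0 \<le> ?w c x"
        using nonneg[OF that] by simp
    qed
  qed
  \<comment> \<open>A single chart with positive level \<open>k c\<close> suffices to treat the
    whole piece \<open>E k\<close>, with k c / N as lower bound for the weight.\<close>
  have piece: "?f ` E k \<in> lmeasurable"
      "k c / N * ?\<mu> (?f ` E k) \<le> integral (S c k) (?w c)"
    if c: "c \<in> C" "k c > 0" for c k
  proof -
    have \<rho>: "k c / N \<le> \<rho> c p" if "\<kappa> p = k" for p
    proof -
      have "k c = \<lfloor>N * \<rho> c p\<rfloor>"
        using that c(1) by (auto simp: \<kappa>_def)
      then have "k c \<le> N * \<rho> c p"
        by linarith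
      then show ?thesis
        using N0 by (simp add: field_simps)
    qed
    have pos: "k c / N > 0"
      using c(2) N0 by simp
    \<comment> \<open>On \<open>E k\<close> the weight \<open>\<rho> c\<close> is positive, so all
      of \<open>E k\<close> lies in the domain of \<open>c\<close>.\<close>
    have "E k = chart_inv c ` S c k"
    proof
      show "E k \<subseteq> chart_inv c ` S c k"
      proof
        fix p assume p: "p \<in> E k"
        then have "p \<in> chart_dom c"
          using supp[OF c(1), of p] \<rho>[of p] pos by (auto simp: E_def)
        then show "p \<in> chart_inv c ` S c k"
          using p chart_inv_map[OF C(1)[OF c(1)]] by (intro image_eqI[of _ _ "chart_map c p"]) (auto simp: S_def E_def)
      qed
      show "chart_inv c ` S c k \<subseteq> E k"
        using inM[OF c(1)] by (auto simp: S_def E_def)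
    qed
    then have "?f ` E k = (\<lambda>x. \<chi> i. F i (chart_inv c x)) ` S c k"
      by (simp add: image_image)
    moreover have "S c k \<subseteq> chart_codom c" "\<And>x. x \<in> S c k \<Longrightarrow> k c / N \<le> \<rho> c (chart_inv c x)"
      using \<rho> by (auto simp: S_def)
    ultimately show "?f ` E k \<in> lmeasurable" "k c / N * ?\<mu> (?f ` E k) \<le> integral (S c k) (?w c)"
      using weighted_image_measure[OF part c(1) F S_borel[OF c(1)] _ pos] by simp_all
  qed
  have level: "?f ` E k \<in> lmeasurable \<and>
      (1 - card C / N) * ?\<mu> (?f ` E k) \<le> (\<Sum>c\<in>C. integral (S c k) (?w c))" if "k \<in> T" for k
  proof (cases "E k = {}")
    case True
    then show ?thesis
      using w_nonneg by (simp add: sum_nonneg)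
  next
    case False
    then obtain p where p: "p \<in> M" "k = \<kappa> p"
      by (auto simp: E_def)
    \<comment> \<open>Rounding down costs at most 1 / N per chart, and the weights at
      \<open>p\<close> sum to 1.\<close>
    have "1 - card C / N = (\<Sum>c\<in>C. \<rho> c p - 1 / N)"
      by (simp add: sum_subtractf sum p(1))
    also have "\<dots> \<le> (\<Sum>c\<in>C. k c / N)"
    proof (rule sum_mono)
      fix c assume "c \<in> C"
      then have "k c = \<lfloor>N * \<rho> c p\<rfloor>"
        by (simp add: p(2) \<kappa>_def)
      then have "N * \<rho> c p \<le> k c + 1"
        by linarith
      then have "\<rho> c p \<le> (k c + 1) / N"
        using N0 by (simp add: pos_le_divide_eq mult.commute)
      then show "\<rho> c p - 1 / N \<le> k c / N"
        by (simp add: add_divide_distrib)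
    qed
    finally have le: "1 - card C / N \<le> (\<Sum>c\<in>C. k c / N)" .
    \<comment> \<open>As \<open>N\<close> exceeds \<open>card C\<close>, the rounded weights cannot
      all be 0; hence \<open>E k\<close> lies in some chart, and its image is measurable.\<close>
    have "\<exists>c\<in>C. k c > 0"
    proof (rule ccontr)
      assume "\<not> ?thesis"
      then have "(\<Sum>c\<in>C. k c / N) \<le> 0"
        using N0 by (intro sum_nonpos) (auto simp: field_simps not_less)
      moreover have "1 - card C / N > 0"
        using N N0 by (simp add: field_simps)
      ultimately show False
        using le by linarith
    qed
    then have meas: "?f ` E k \<in> lmeasurable"
      using piece(1) by blast
    have "(1 - card C / N) * ?\<mu> (?f ` E k) \<le> (\<Sum>c\<in>C. k c / N) * ?\<mu> (?f ` E k)"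
      using le by (rule mult_right_mono) simp
    also have "\<dots> = (\<Sum>c\<in>C. k c / N * ?\<mu> (?f ` E k))"
      by (rule sum_distrib_right)
    also have "\<dots> \<le> (\<Sum>c\<in>C. integral (S c k) (?w c))"
    proof (rule sum_mono)
      fix c assume c: "c \<in> C"
      show "k c / N * ?\<mu> (?f ` E k) \<le> integral (S c k) (?w c)"
      proof (cases "k c > 0")
        case True
        then show ?thesis
          by (rule piece(2)[OF c])
      next
        case False
        then have "k c = 0"
          using \<open>k \<in> T\<close> c by (force simp: T_def)
        then show ?thesis
          using w_nonneg[OF c] by simp
      qed
    qed
    finally show ?thesis
      using meas by blast
  qed
  have M: "?f ` M = (\<Union>k\<in>T. ?f ` E k)"
    using \<kappa>_T by (auto simp: E_def)
  show "?f ` M \<in> lmeasurable"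
    unfolding M using level T by (intro fmeasurable.finite_UN) auto
  have "?\<mu> (?f ` M) \<le> (\<Sum>k\<in>T. ?\<mu> (?f ` E k))"
    unfolding M using level by (intro measure_UNION_le[OF T]) (auto simp: fmeasurable_def)
  then have "(1 - card C / N) * ?\<mu> (?f ` M) \<le> (1 - card C / N) * (\<Sum>k\<in>T. ?\<mu> (?f ` E k))"
    using N N0 by (intro mult_left_mono) (auto simp: field_simps)
  also have "\<dots> \<le> (\<Sum>k\<in>T. \<Sum>c\<in>C. integral (S c k) (?w c))"
    unfolding sum_distrib_left using level by (intro sum_mono) blast
  also have "\<dots> = (\<Sum>c\<in>C. \<Sum>k\<in>T. integral (S c k) (?w c))"
    by (rule sum.swap)
  \<comment> \<open>For a fixed chart the sets \<open>S c k\<close> partition its image, so the sum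
    over levels reassembles the integral.\<close>
  also have "\<dots> = (\<Sum>c\<in>C. integral (chart_codom c) (?w c))"
  proof (rule sum.cong[OF refl])
    fix c assume c: "c \<in> C"
    have codom: "chart_codom c = (\<Union>k\<in>T. S c k)"
      using \<kappa>_T[OF inM[OF c]] by (auto simp: S_def)
    have "(?w c has_integral (\<Sum>k\<in>T. integral (S c k) (?w c))) (\<Union>k\<in>T. S c k)"
    proof (rule has_integral_UN[OF T])
      show "(?w c has_integral integral (S c k) (?w c)) (S c k)" for k
        using w_int[OF c] by blast
      show "pairwise (\<lambda>k k'. negligible (S c k \<inter> S c k')) T"
        unfolding pairwise_def
      proof (intro ballI impI)
        fix k k' :: "('a, 'n) chart \<Rightarrow> int" assume "k \<noteq> k'"
        then have "S c k \<inter> S c k' = {}"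
          by (auto simp: S_def)
        then show "negligible (S c k \<inter> S c k')"
          by simp
      qed
    qed
    then show "(\<Sum>k\<in>T. integral (S c k) (?w c)) = integral (chart_codom c) (?w c)"
      unfolding codom by (rule integral_unique[symmetric])
  qed
  finally show "(1 - card C / N) * ?\<mu> (?f ` M) \<le> (\<Sum>c\<in>C. integral (chart_codom c) (?w c))" .
qed

text \<open>The loss factor 1 - card C / N tends to 1 as the subdivision is refined.\<close>

lemma measure_image_le_L1_norm:
  assumes "compact M" and F: "\<forall>i. F i \<in> smooth_functions A"
  shows "(\<lambda>p. \<chi> i. F i p) ` M \<in> lmeasurable"
    and "measure lebesgue ((\<lambda>p. \<chi> i. F i p) ` M) \<le> L1_norm M A \<Omega> (bracket A \<Omega> F)"
proof -
  let ?f = "\<lambda>p. \<chi> i. F i p"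
  obtain C \<rho> where part: "oriented_partition M A \<Omega> C \<rho>" and L1: "L1_norm M A \<Omega> (bracket A \<Omega> F) =
      (\<Sum>c\<in>C. integral (chart_codom c) (\<lambda>x. \<rho> c (chart_inv c x) * \<bar>det (jacobian c F x)\<bar>))"
    using L1_norm_bracket[OF assms] by blast
  show "?f ` M \<in> lmeasurable"
    by (rule measure_image_le_approx(1)[OF part F, of "Suc (card C)"]) simp
  have "(\<lambda>N. (1 - card C / real N) * measure lebesgue (?f ` M)) \<longlonglongrightarrow> (1 - 0) * measure lebesgue (?f ` M)"
    by (intro tendsto_intros lim_const_over_n)
  moreover have "\<forall>N\<ge>Suc (card C). (1 - card C / real N) * measure lebesgue (?f ` M) \<le> L1_norm M A \<Omega> (bracket A \<Omega> F)"
    using measure_image_le_approx(2)[OF part F] unfolding L1 Suc_le_eq by blast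
  ultimately have "(1 - 0) * measure lebesgue (?f ` M) \<le> L1_norm M A \<Omega> (bracket A \<Omega> F)"
    by (intro LIMSEQ_le_const2) auto
  then show "measure lebesgue (?f ` M) \<le> L1_norm M A \<Omega> (bracket A \<Omega> F)"
    by simp
qed

end

section \<open>Avoiding a lattice and the staircase function\<close>

text \<open>If every \<open>t\<close> in the cell \<open>Q\<close> had a lattice point
  \<open>t + v k\<close> in \<open>K\<close>, the pieces of \<open>K\<close> in the lattice cells,
  all moved back into \<open>Q\<close>, would cover it; but their total measure is at most that of
  \<open>K\<close>.\<close>

lemma lattice_translate_avoids:
  fixes K :: "(real ^ 'n::finite) set"
  assumes K: "bounded K" "K \<in> lmeasurable" and \<delta>: "\<delta> > 0"
    and small: "measure lebesgue K < \<delta> ^ CARD('n)"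
  shows "\<exists>t. \<forall>k :: 'n \<Rightarrow> int. t + (\<chi> i. \<delta> * k i) \<notin> K"
proof (rule ccontr)
  assume hit: "\<not> ?thesis"
  define v where "v k = (\<chi> i. \<delta> * real_of_int (k i))" for k :: "'n \<Rightarrow> int"
  \<comment> \<open>The open box keeps distinct cells disjoint and has the same measure as the
    closed one.\<close>
  define Q where "Q = box 0 ((\<chi> i. \<delta>) :: real ^ 'n)"
  define P where "P k = K \<inter> (+) (v k) ` Q" for k
  obtain B where B: "\<And>x. x \<in> K \<Longrightarrow> norm x \<le> B"
    using K(1) by (auto simp: bounded_iff)
  \<comment> \<open>Boundedness of \<open>K\<close> leaves finitely many cells; the extra 1 accounts
    for the offset of \<open>t\<close> within its cell.\<close>
  define b where "b = \<lceil>B / \<delta>\<rceil> + 1"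
  define T where "T = {k :: 'n \<Rightarrow> int. \<forall>i. k i \<in> {- b..b}}"
  have "T = (UNIV \<rightarrow>\<^sub>E {- b..b})"
    by (auto simp: T_def PiE_def)
  then have T: "finite T"
    by (simp add: finite_PiE)
  have P_meas: "P k \<in> lmeasurable" for k
    unfolding P_def Q_def by (intro fmeasurable.Int K measurable_translation lmeasurable_box)
  have "Q \<subseteq> (\<Union>k\<in>T. (\<lambda>x. x - v k) ` P k)"
  proof
    fix t assume t: "t \<in> Q"
    obtain k where k: "t + v k \<in> K"
      using hit by (auto simp: v_def)
    have "k i \<in> {- b..b}" for i
    proof -
      have "\<bar>t $ i + \<delta> * k i\<bar> \<le> B"
        using order_trans[OF component_le_norm_cart[of "t + v k" i] B[OF k]] by (simp add: v_def)
      moreover have "0 < t $ i" "t $ i < \<delta>"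
        using t by (auto simp: Q_def mem_box_cart)
      ultimately have "\<delta> * k i \<le> B" "- B - \<delta> \<le> \<delta> * k i"
        by linarith+
      then have "k i \<le> B / \<delta>" "- (B / \<delta>) - 1 \<le> k i"
        using \<delta> by (simp_all add: field_simps)
      then show ?thesis
        unfolding b_def atLeastAtMost_iff by linarith
    qed
    moreover have "t \<in> (\<lambda>x. x - v k) ` P k"
      using k t by (intro image_eqI[of _ _ "t + v k"]) (auto simp: P_def add.commute)
    ultimately show "t \<in> (\<Union>k\<in>T. (\<lambda>x. x - v k) ` P k)"
      by (auto simp: T_def)
  qed
  then have "measure lebesgue Q \<le> measure lebesgue (\<Union>k\<in>T. (\<lambda>x. x - v k) ` P k)"
    using P_meas T by (intro measure_mono_fmeasurable fmeasurable.finite_UN measurable_translation_subtract)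
      (auto simp: Q_def)
  also have "\<dots> \<le> (\<Sum>k\<in>T. measure lebesgue ((\<lambda>x. x - v k) ` P k))"
    using P_meas T by (intro measure_UNION_le) (auto intro!: fmeasurableD measurable_translation_subtract)
  also have "\<dots> = (\<Sum>k\<in>T. measure lebesgue (P k))"
    by (simp add: measure_translation_subtract)
  also have "\<dots> = measure lebesgue (\<Union>k\<in>T. P k)"
  proof (rule measure_UNION'[OF T, symmetric])
    show "pairwise (\<lambda>k k'. disjnt (P k) (P k')) T"
      unfolding pairwise_def disjnt_iff
    proof (intro ballI impI allI notI)
      fix k k' x assume "k \<noteq> k'" and x: "x \<in> P k \<and> x \<in> P k'"
      have "\<delta> * k i < x $ i \<and> x $ i < \<delta> * (k i + 1)" if "x \<in> P k" for k i
        using that by (auto simp: P_def Q_def v_def mem_box_cart algebra_simps)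
      then have "\<delta> * k i < \<delta> * (k' i + 1)" "\<delta> * k' i < \<delta> * (k i + 1)" for i
        using x by (meson less_trans)+
      then have "real_of_int (k i) < k' i + 1" "real_of_int (k' i) < k i + 1" for i
        using \<delta> by simp_all
      then have "k i = k' i" for i
        by (metis linorder_neqE_linordered_idom of_int_add of_int_less_iff of_int_1 zless_imp_add1_zle linorder_not_less of_int_le_iff)
      then have "k = k'"
        by auto
      then show False
        using \<open>k \<noteq> k'\<close> by simp
    qed
  qed (rule P_meas)
  also have "\<dots> \<le> measure lebesgue K"
    using P_meas K(2) T by (intro measure_mono_fmeasurable) (auto simp: P_def[symmetric] intro!: sets.finite_UN, auto simp: P_def)
  finally have "measure lebesgue Q < \<delta> ^ CARD('n)"
    using small by simp
  moreover have "measure lebesgue Q = measure lborel (cbox 0 ((\<chi> i. \<delta>) :: real ^ 'n))"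
    by (simp add: Q_def measure_lborel_box_eq measure_lborel_cbox_eq)
  moreover have "cbox 0 ((\<chi> i. \<delta>) :: real ^ 'n) \<noteq> {}"
    using \<delta> by (auto simp: interval_ne_empty_cart)
  ultimately show False
    by (simp add: content_cbox_cart)
qed

text \<open>The translated lattice is closed, so the compact \<open>K\<close> keeps a positive
  distance from it. A point with all coordinates near their closest lattice values would be too near
  to a lattice point.\<close>

lemma lattice_distance:
  fixes K :: "(real ^ 'n::finite) set"
  assumes "compact K" and \<delta>: "\<delta> > 0" and avoid: "\<And>k :: 'n \<Rightarrow> int. t + (\<chi> i. \<delta> * k i) \<notin> K"
  shows "\<exists>s>0. \<forall>y\<in>K. \<exists>i. s < \<bar>(y $ i - t $ i) / \<delta> - round ((y $ i - t $ i) / \<delta>)\<bar>"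
proof -
  define \<Lambda> where "\<Lambda> = (\<Inter>i. (\<lambda>x :: real ^ 'n. (x $ i - t $ i) / \<delta>) -` \<int>)"
  have "closed \<Lambda>"
    unfolding \<Lambda>_def using \<delta> by (intro closed_INT ballI continuous_closed_vimage closed_Ints) (auto intro!: continuous_intros)
  moreover have \<Lambda>: "x \<in> \<Lambda> \<longleftrightarrow> (\<exists>k :: 'n \<Rightarrow> int. x = t + (\<chi> i. \<delta> * k i))" for x
  proof
    assume "x \<in> \<Lambda>"
    then have "\<forall>i. \<exists>m :: int. (x $ i - t $ i) / \<delta> = m"
      by (auto simp: \<Lambda>_def elim!: Ints_cases)
    then obtain k :: "'n \<Rightarrow> int" where "\<And>i. (x $ i - t $ i) / \<delta> = k i"
      by metis
    then have "x $ i = t $ i + \<delta> * k i" for i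
      using \<delta> by (simp add: field_simps)
    then show "\<exists>k :: 'n \<Rightarrow> int. x = t + (\<chi> i. \<delta> * k i)"
      by (intro exI[of _ k]) (simp add: vec_eq_iff)
  qed (use \<delta> in \<open>auto simp: \<Lambda>_def\<close>)
  moreover have "K \<inter> \<Lambda> = {}"
    using avoid \<Lambda> by (metis disjoint_iff)
  ultimately obtain d where d: "d > 0" "\<And>x y. x \<in> K \<Longrightarrow> y \<in> \<Lambda> \<Longrightarrow> d \<le> dist x y"
    using separate_compact_closed[OF assms(1)] by metis
  \<comment> \<open>Coordinates all within \<delta> s of a lattice point give an l1 distance of at
    most n \<delta> s = d / 2.\<close>
  define s where "s = d / (2 * \<delta> * CARD('n))"
  have "\<exists>i. s < \<bar>(y $ i - t $ i) / \<delta> - round ((y $ i - t $ i) / \<delta>)\<bar>" if "y \<in> K" for y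
  proof (rule ccontr)
    assume *: "\<not> ?thesis"
    define k where "k i = round ((y $ i - t $ i) / \<delta>)" for i
    define z where "z = t + (\<chi> i. \<delta> * k i)"
    have "\<bar>(y - z) $ i\<bar> \<le> \<delta> * s" for i
    proof -
      have "(y - z) $ i = \<delta> * ((y $ i - t $ i) / \<delta> - k i)"
        using \<delta> by (simp add: z_def field_simps)
      moreover have "\<bar>(y $ i - t $ i) / \<delta> - k i\<bar> \<le> s"
        using * by (auto simp: k_def not_less)
      ultimately show ?thesis
        using \<delta> by (simp add: abs_mult mult_left_mono)
    qed
    then have "norm (y - z) \<le> (\<Sum>i\<in>(UNIV :: 'n set). \<delta> * s)"
      using norm_le_l1_cart[of "y - z"] by (meson order_trans sum_mono)
    also have "\<dots> = d / 2"
      using \<delta> by (simp add: s_def)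
    also have "\<dots> < d"
      using d(1) by simp
    finally show False
      using d(2)[OF that, of z] \<Lambda>[of z] by (auto simp: z_def dist_norm)
  qed
  moreover have "s > 0"
    using d(1) \<delta> by (simp add: s_def)
  ultimately show ?thesis
    by blast
qed

text \<open>Outside the \<open>s\<close>-neighbourhood of the integers, \<open>stair s\<close> rounds to the nearest element of \<open>\<int> + 1/2\<close>.\<close>

definition stair :: "real \<Rightarrow> real \<Rightarrow> real" where
  "stair s x = of_int (round x) - 1 / 2 + step ((x - of_int (round x)) / s)"

text \<open>The defining formula switches integers at half-integers, where \<open>step\<close> is
  already saturated: passing to a neighbouring \<open>m\<close> changes \<open>m - 1 / 2\<close> by
  1 and \<open>step\<close> by 1 the other way. So one formula holds on an interval of radius 1 - s
  > 1/2, and such open intervals around the integers cover the line.\<close>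

lemma stair_eq:
  fixes s y :: real and m :: int
  assumes s: "0 < s" "s < 1 / 2" and y: "\<bar>y - m\<bar> < 1 - s"
  shows "stair s y = m - 1 / 2 + step ((y - m) / s)"
proof -
  have r: "\<bar>round y - y\<bar> \<le> 1 / 2"
    by (rule of_int_round_abs_le)
  consider "round y = m" | "round y < m" | "round y > m"
    by linarith
  then show ?thesis
  proof cases
    case 1
    then show ?thesis
      by (simp add: stair_def)
  next
    case 2
    have "round y = m - 1"
      using 2 r y s by linarith
    moreover have "step ((y - m) / s) = 0" "step ((y - (m - 1)) / s) = 1"
      using calculation r y s by (auto intro!: step_eq_0 step_eq_1 simp: field_simps abs_le_iff abs_less_iff)
    ultimately show ?thesis
      by (simp add: stair_def)
  next
    case 3
    have "round y = m + 1"
      using 3 r y s by linarith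
    moreover have "step ((y - m) / s) = 1" "step ((y - (m + 1)) / s) = 0"
      using calculation r y s by (auto intro!: step_eq_0 step_eq_1 simp: field_simps abs_le_iff abs_less_iff)
    ultimately show ?thesis
      by (simp add: stair_def)
  qed
qed

lemma smooth_on_stair:
  assumes s: "0 < s" "s < 1 / 2"
  shows "smooth_on UNIV (stair s)"
proof (rule smooth_on_local)
  fix x :: real
  let ?m = "real_of_int (round x)" and ?U = "ball (real_of_int (round x)) (1 - s)"
  have lin: "smooth_on ?U (\<lambda>y. (y - ?m) / s)"
    using s by (intro smooth_on_divide smooth_on_diff smooth_on_id smooth_on_const) auto
  have "smooth_on ?U (\<lambda>y. step ((y - ?m) / s))"
    by (rule smooth_on_compose[OF _ _ _ lin smooth_on_step]) auto
  then have "smooth_on ?U (\<lambda>y. ?m - 1 / 2 + step ((y - ?m) / s))"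
    by (intro smooth_on_add smooth_on_const) auto
  moreover have "stair s y = ?m - 1 / 2 + step ((y - ?m) / s)" if "y \<in> ?U" for y
    using stair_eq[OF s, of y "round x"] that by (simp add: dist_real_def abs_minus_commute)
  ultimately have "smooth_on ?U (stair s)"
    using smooth_on_cong[of ?U "stair s"] by simp
  moreover have "x \<in> ?U"
    using of_int_round_abs_le[of x] s by (simp add: dist_real_def)
  ultimately show "\<exists>U. open U \<and> x \<in> U \<and> smooth_on U (stair s)"
    by blast
qed

text \<open>On the flat parts the value is the nearest point of Z + 1/2, at distance at most 1/2; in
  the transition |u| < s and \<open>step\<close> lies between 0 and 1.\<close>

lemma stair_dist:
  assumes s: "0 < s"
  shows "\<bar>stair s x - x\<bar> \<le> 1 / 2 + s"
proof -
  define u where "u = x - of_int (round x)"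
  have u: "\<bar>u\<bar> \<le> 1 / 2"
    using of_int_round_abs_le[of x] by (simp add: u_def abs_minus_commute)
  have st: "stair s x - x = step (u / s) - 1 / 2 - u"
    by (simp add: stair_def u_def)
  consider "u \<le> - s" | "u \<ge> s" | "\<bar>u\<bar> < s"
    by linarith
  then show ?thesis
  proof cases
    case 1
    then have "step (u / s) = 0"
      using s by (intro step_eq_0) (simp add: field_simps)
    then show ?thesis
      using 1 u s unfolding st by linarith
  next
    case 2
    then have "step (u / s) = 1"
      using s by (intro step_eq_1) (simp add: field_simps)
    then show ?thesis
      using 2 u s unfolding st by linarith
  next
    case 3
    then show ?thesis
      using step_range[of "u / s"] unfolding st by linarith
  qed
qed

text \<open>\<open>step\<close> is saturated on the whole open gap between two neighbouring
  transition zones.\<close>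

lemma stair_locally_constant:
  fixes s x :: real
  assumes s: "0 < s" "s < 1 / 2" and x: "\<bar>x - round x\<bar> > s"
  shows "\<exists>U. open U \<and> x \<in> U \<and> (\<forall>y\<in>U. stair s y = stair s x)"
proof -
  let ?m = "real_of_int (round x)"
  have r: "\<bar>x - ?m\<bar> \<le> 1 / 2"
    using of_int_round_abs_le[of x] by (simp add: abs_minus_commute)
  show ?thesis
  proof (cases "x > ?m")
    case True
    let ?U = "{?m + s<..<?m + 1 - s}"
    have "stair s y = ?m + 1 / 2" if "y \<in> ?U" for y
      using that s stair_eq[OF s, of y "round x"] step_eq_1[of "(y - ?m) / s"]
      by (simp add: field_simps abs_less_iff)
    moreover have "x \<in> ?U"
      using True r x s by auto
    ultimately show ?thesis
      by (intro exI[of _ ?U]) auto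
  next
    case False
    let ?U = "{?m - 1 + s<..<?m - s}"
    have "stair s y = ?m - 1 / 2" if "y \<in> ?U" for y
      using that s stair_eq[OF s, of y "round x"] step_eq_0[of "(y - ?m) / s"]
      by (simp add: field_simps abs_less_iff)
    moreover have "x \<in> ?U"
      using False r x s by auto
    ultimately show ?thesis
      by (intro exI[of _ ?U]) auto
  qed
qed

section \<open>Perturbing to a vanishing bracket\<close>

context smooth_atlas
begin

lemma smooth_function_continuous:
  assumes "f \<in> smooth_functions A"
  shows "continuous_on M f"
  unfolding continuous_openin_preimage_eq
proof (intro allI impI)
  fix T :: "real set" assume T: "open T"
  let ?V = "\<lambda>c. chart_codom c \<inter> (f \<circ> chart_inv c) -` T"
  have "openin (top_of_set M) {p \<in> chart_dom c. chart_map c p \<in> ?V c}" if c: "c \<in> A" for c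
    by (rule openin_chart_preimage[OF c continuous_open_preimage[OF
          smooth_on_continuous[OF smooth_functionsD[OF assms c]] open_chart_codom[OF c] T]])
  then have "openin (top_of_set M) (\<Union>c\<in>A. {p \<in> chart_dom c. chart_map c p \<in> ?V c})"
    by (intro openin_Union) blast
  moreover have "(\<Union>c\<in>A. {p \<in> chart_dom c. chart_map c p \<in> ?V c}) = M \<inter> f -` T"
  proof (intro equalityI subsetI)
    fix p assume "p \<in> (\<Union>c\<in>A. {p \<in> chart_dom c. chart_map c p \<in> ?V c})"
    then obtain c where "c \<in> A" "p \<in> chart_dom c" "f (chart_inv c (chart_map c p)) \<in> T"
      by auto
    then show "p \<in> M \<inter> f -` T"
      using chart_dom_subset[of c] by (auto simp: chart_inv_map)
  next
    fix p assume p: "p \<in> M \<inter> f -` T"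
    then obtain c where "c \<in> A" "p \<in> chart_dom c"
      using chart_cover by blast
    then show "p \<in> (\<Union>c\<in>A. {p \<in> chart_dom c. chart_map c p \<in> ?V c})"
      using p by (intro UN_I[of c]) (auto simp: chart_inv_map)
  qed
  ultimately show "openin (top_of_set M) (M \<inter> f -` T)"
    by simp
qed

lemma jacobian_det_eq_0:
  assumes "open U" "x \<in> U" "\<And>y. y \<in> U \<Longrightarrow> F i (chart_inv c y) = a"
  shows "det (jacobian c F x) = 0"
proof -
  have "frechet_derivative (F i \<circ> chart_inv c) (at x) = frechet_derivative (\<lambda>_. a) (at x)"
    by (rule frechet_derivative_cong_open[OF assms(1,2)]) (use assms(3) in simp)
  then have "row i (jacobian c F x) = 0"
    by (simp add: row_def jacobian_def vec_eq_iff frechet_derivative_const)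
  then show ?thesis
    by (rule det_zero_row)
qed

end

context smooth_volume
begin

text \<open>Nonnegative integrals with sum at most 0 are all 0. Some weight is nonzero at
  \<open>p\<close>, and in that chart a continuous nonnegative integrand with zero integral vanishes
  at the image of \<open>p\<close>, so its other factor, the determinant, is 0.\<close>

lemma L1_norm_bracket_le_0:
  assumes "compact M" and F: "\<forall>i. F i \<in> smooth_functions A"
    and L1: "L1_norm M A \<Omega> (bracket A \<Omega> F) \<le> 0" and p: "p \<in> M"
  shows "bracket A \<Omega> F p = 0"
proof -
  obtain C \<rho> where part: "oriented_partition M A \<Omega> C \<rho>" and eq: "L1_norm M A \<Omega> (bracket A \<Omega> F) =
      (\<Sum>c\<in>C. integral (chart_codom c) (\<lambda>x. \<rho> c (chart_inv c x) * \<bar>det (jacobian c F x)\<bar>))"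
    using L1_norm_bracket[OF assms(1) F] by blast
  let ?w = "\<lambda>c x. \<rho> c (chart_inv c x) * \<bar>det (jacobian c F x)\<bar>"
  have fin: "finite C" and C: "\<And>c. c \<in> C \<Longrightarrow> c \<in> A" "\<And>c. c \<in> C \<Longrightarrow> \<rho> c \<in> smooth_functions A"
    and nonneg: "\<And>c p. c \<in> C \<Longrightarrow> p \<in> M \<Longrightarrow> 0 \<le> \<rho> c p"
    and sum: "\<And>p. p \<in> M \<Longrightarrow> (\<Sum>c\<in>C. \<rho> c p) = 1"
    and supp: "\<And>c p. c \<in> C \<Longrightarrow> p \<in> M \<Longrightarrow> \<rho> c p \<noteq> 0 \<Longrightarrow> p \<in> chart_dom c"
    using part unfolding oriented_partition_def oriented_chart_def by blast+
  have w_nonneg: "0 \<le> ?w c x" if "c \<in> C" "x \<in> chart_codom c" for c x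
  proof -
    have "chart_inv c x \<in> M"
      using chart_inv_in_dom[OF that(2)] chart_dom_subset[OF C(1)[OF that(1)]] by blast
    then show ?thesis
      using nonneg[OF that(1)] by simp
  qed
  have w_int: "?w c integrable_on chart_codom c" if "c \<in> C" for c
    by (rule set_borel_integral_eq_integral(1)[OF weight_integrable[OF part that F]])
  have int_nonneg: "0 \<le> integral (chart_codom c) (?w c)" if "c \<in> C" for c
    by (rule integral_nonneg[OF w_int[OF that] w_nonneg[OF that]])
  obtain c where c: "c \<in> C" "\<rho> c p \<noteq> 0"
    using sum[OF p] by (metis sum.neutral zero_neq_one)
  let ?x = "chart_map c p"
  have dom: "p \<in> chart_dom c"
    by (rule supp[OF c(1) p c(2)])
  have "(\<Sum>c\<in>C. integral (chart_codom c) (?w c)) = 0"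
    using L1 eq int_nonneg by (intro antisym sum_nonneg) auto
  then have int_0: "integral (chart_codom c) (?w c) = 0"
    using sum_nonneg_eq_0_iff[OF fin, of "\<lambda>c. integral (chart_codom c) (?w c)"] int_nonneg c(1) by blast
  have "?x \<in> chart_codom c"
    using dom by simp
  then obtain a b where ab: "cbox a b \<subseteq> chart_codom c" "?x \<in> box a b" "\<forall>i\<in>Basis. a \<bullet> i < b \<bullet> i"
    by (rule open_contains_cbox[OF open_chart_codom[OF C(1)[OF c(1)]]])
  have "continuous_on (chart_codom c) (?w c)"
    using smooth_on_continuous[OF smooth_functionsD[OF C(2,1)[OF c(1)]]]
    by (intro continuous_on_mult continuous_on_jacobian_det[OF F C(1)[OF c(1)]]) (simp add: o_def)
  then have cont: "continuous_on (cbox a b) (?w c)"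
    by (rule continuous_on_subset[OF _ ab(1)])
  have box: "?w c integrable_on cbox a b"
    by (rule integrable_continuous[OF cont])
  have "integral (cbox a b) (?w c) \<le> integral (chart_codom c) (?w c)"
    by (intro integral_subset_le[OF ab(1) box w_int[OF c(1)]] ballI w_nonneg[OF c(1)])
  moreover have "0 \<le> integral (cbox a b) (?w c)"
    using ab(1) by (intro integral_nonneg[OF box] w_nonneg[OF c(1)]) auto
  ultimately have "integral (cbox a b) (?w c) = 0"
    using int_0 by simp
  then have "(?w c has_integral 0) (cbox a b)"
    using integrable_integral[OF box] by simp
  moreover have "0 \<le> ?w c y" if "y \<in> box a b" for y
    using that ab(1) box_subset_cbox[of a b] by (intro w_nonneg[OF c(1)]) blast
  moreover have "box a b \<noteq> {}" "?x \<in> cbox a b"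
    using ab(2) box_subset_cbox[of a b] by blast+
  ultimately have "?w c ?x = 0"
    by (intro has_integral_0_cbox_imp_0[OF cont])
  then have "det (jacobian c F ?x) = 0"
    using c(2) by (simp add: chart_inv_map[OF C(1)[OF c(1)] dom])
  then show ?thesis
    using bracket_eq_0_iff[OF F C(1)[OF c(1)] dom] by simp
qed

lemma bracket_eq_0_locally_constant:
  assumes F: "\<forall>i. F i \<in> smooth_functions A" and p: "p \<in> M"
    and U: "openin (top_of_set M) U" "p \<in> U" "\<And>q. q \<in> U \<Longrightarrow> F i q = F i p"
  shows "bracket A \<Omega> F p = 0"
proof -
  obtain c where c: "c \<in> A" "p \<in> chart_dom c"
    using chart_cover[OF p] by blast
  have "det (jacobian c F (chart_map c p)) = 0"
  proof (rule jacobian_det_eq_0)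
    show "open (chart_map c ` (chart_dom c \<inter> U))"
      by (rule open_chart_image[OF c(1) U(1)])
    show "F i (chart_inv c y) = F i p" if "y \<in> chart_map c ` (chart_dom c \<inter> U)" for y
      using that U(3) by (auto simp: chart_inv_map[OF c(1)])
  qed (use c(2) U(2) in auto)
  then show ?thesis
    using bracket_eq_0_iff[OF F c] by simp
qed

text \<open>The image of a component is an interval, so differences of values there are measures of
  segments inside the image of \<open>M\<close>. Components are open in \<open>M\<close>, hence a
  function depending only on the component is locally constant and therefore smooth.\<close>

lemma perturbation_dim_1:
  assumes "compact M" and F: "\<forall>i. F i \<in> smooth_functions A" and dim: "CARD('n) = 1"
    and L1: "L1_norm M A \<Omega> (bracket A \<Omega> F) \<le> 2 * \<epsilon>"
  shows "\<exists>F'. (\<forall>i. F' i \<in> smooth_functions A) \<and> (\<forall>i. \<forall>p\<in>M. \<bar>F i p - F' i p\<bar> \<le> \<epsilon>) \<and>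
    (\<forall>p\<in>M. bracket A \<Omega> F' p = 0)"
proof -
  let ?f = "\<lambda>p. \<chi> i. F i p"
  obtain e :: 'n where UNIV_e: "UNIV = {e}"
    using dim by (rule card_1_singletonE)
  then have e: "i = e" for i
    by blast
  define Q where "Q p = connected_component_set M p" for p
  have Q_refl: "p \<in> Q p" if "p \<in> M" for p
    using that by (simp add: Q_def)
  have osc: "F i q - F i q' \<le> 2 * \<epsilon>" if q: "q \<in> Q p" "q' \<in> Q p" for i p q q'
  proof (cases "F i q' \<le> F i q")
    case True
    have "connected (F i ` Q p)"
      unfolding Q_def
      by (intro connected_continuous_image continuous_on_subset[OF smooth_function_continuous[OF F[rule_format]]]
          connected_component_subset connected_connected_component)
    then have seg: "{F i q'..F i q} \<subseteq> F i ` Q p"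
      using q by (intro connected_contains_Icc) auto
    have "cbox (?f q') (?f q) \<subseteq> ?f ` M"
    proof
      fix y assume "y \<in> cbox (?f q') (?f q)"
      then have "y $ i \<in> F i ` Q p"
        using seg by (auto simp: mem_box_cart)
      then obtain p' where "p' \<in> M" "y $ i = F i p'"
        using connected_component_subset[of M p] by (auto simp: Q_def)
      then show "y \<in> ?f ` M"
        using e by (intro image_eqI[of _ _ p']) (auto simp: vec_eq_iff, metis)
    qed
    then have "measure lebesgue (cbox (?f q') (?f q)) \<le> measure lebesgue (?f ` M)"
      by (intro measure_mono_fmeasurable measure_image_le_L1_norm(1)[OF assms(1) F]) auto
    also have "\<dots> \<le> 2 * \<epsilon>"
      using measure_image_le_L1_norm(2)[OF assms(1) F] L1 by simp
    also have "measure lebesgue (cbox (?f q') (?f q)) = F i q - F i q'"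
    proof -
      have "F e q' \<le> F e q"
        using True e by metis
      then have "cbox (?f q') (?f q) \<noteq> {}"
        by (auto simp: interval_ne_empty_cart) (metis e)
      then have "measure lebesgue (cbox (?f q') (?f q)) = F e q - F e q'"
        by (simp add: content_cbox_cart UNIV_e)
      then show ?thesis
        using e by metis
    qed
    finally show ?thesis .
  next
    case False
    \<comment> \<open>The difference is negative in this case, and \<epsilon> \<ge> 0 is read off
      from the measure bound.\<close>
    have "0 \<le> measure lebesgue (?f ` M)"
      by simp
    also have "\<dots> \<le> 2 * \<epsilon>"
      using measure_image_le_L1_norm(2)[OF assms(1) F] L1 by simp
    finally show ?thesis
      using False by simp
  qed
  define F' where "F' i p = (Sup (F i ` Q p) + Inf (F i ` Q p)) / 2" for i p
  have close: "\<bar>F i p - F' i p\<bar> \<le> \<epsilon>" if p: "p \<in> M" for i p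
  proof -
    let ?S = "F i ` Q p"
    have ne: "?S \<noteq> {}" and pS: "F i p \<in> ?S"
      using Q_refl[OF p] by auto
    have le: "a - b \<le> 2 * \<epsilon>" if "a \<in> ?S" "b \<in> ?S" for a b
      using that osc by auto
    have bdd: "bdd_above ?S" "bdd_below ?S"
      using le[OF _ pS] le[OF pS] by (auto intro!: bdd_aboveI[of _ "F i p + 2 * \<epsilon>"] bdd_belowI[of _ "F i p - 2 * \<epsilon>"] simp: algebra_simps)
    have "Sup ?S \<le> 2 * \<epsilon> + Inf ?S"
    proof (rule cSup_least[OF ne])
      fix a assume "a \<in> ?S"
      then have "a - 2 * \<epsilon> \<le> Inf ?S"
        using le by (intro cInf_greatest[OF ne]) (auto simp: algebra_simps)
      then show "a \<le> 2 * \<epsilon> + Inf ?S"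
        by simp
    qed
    moreover have "F i p \<le> Sup ?S" "Inf ?S \<le> F i p"
      using pS bdd by (auto intro: cSup_upper cInf_lower)
    ultimately show ?thesis
      unfolding F'_def by (simp add: abs_le_iff field_simps)
  qed
  \<comment> \<open>A ball in a chart is connected, so its points share one component, and
    \<open>F'\<close> depends on the component only.\<close>
  have local: "\<exists>U. open U \<and> x \<in> U \<and> (\<forall>y\<in>U. \<forall>i. F' i (chart_inv c y) = F' i (chart_inv c x))"
    if c: "c \<in> A" and x: "x \<in> chart_codom c" for c x
  proof -
    obtain r where r: "r > 0" "ball x r \<subseteq> chart_codom c"
      using open_chart_codom[OF c] x by (meson open_contains_ball)
    have conn: "connected (chart_inv c ` ball x r)"
      by (intro connected_continuous_image continuous_on_subset[OF continuous_on_chart_inv[OF c] r(2)] connected_ball)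
    have sub: "chart_inv c ` ball x r \<subseteq> M"
    proof (rule image_subsetI)
      fix y assume "y \<in> ball x r"
      then have "chart_inv c y \<in> chart_dom c"
        using r(2) by (intro chart_inv_in_dom) blast
      then show "chart_inv c y \<in> M"
        using chart_dom_subset[OF c] by blast
    qed
    have Q_eq: "Q (chart_inv c y) = Q (chart_inv c x)" if "y \<in> ball x r" for y
    proof -
      have "chart_inv c y \<in> Q (chart_inv c x)"
        unfolding Q_def
        by (rule subsetD[OF connected_component_maximal[OF _ conn sub]]) (use that r(1) in auto)
      then show ?thesis
        unfolding Q_def by (rule connected_component_eq)
    qed
    show ?thesis
    proof (intro exI conjI ballI allI)
      show "F' i (chart_inv c y) = F' i (chart_inv c x)" if "y \<in> ball x r" for i y
        unfolding F'_def Q_eq[OF that] ..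
    qed (use r(1) in simp_all)
  qed
  have smooth: "F' i \<in> smooth_functions A" for i
    unfolding smooth_functions_def mem_Collect_eq
  proof (intro ballI smooth_on_local)
    fix c x assume "c \<in> A" "x \<in> chart_codom c"
    then obtain U where U: "open U" "x \<in> U" "\<forall>y\<in>U. \<forall>i. F' i (chart_inv c y) = F' i (chart_inv c x)"
      using local by blast
    have "(F' i \<circ> chart_inv c) y = F' i (chart_inv c x)" if "y \<in> U" for y
      unfolding o_apply using U(3) that by blast
    from smooth_on_cong[THEN iffD2, OF U(1) this smooth_on_const]
    have "smooth_on U (F' i \<circ> chart_inv c)" .
    then show "\<exists>U. open U \<and> x \<in> U \<and> smooth_on U (F' i \<circ> chart_inv c)"
      using U by blast
  qed
  have "bracket A \<Omega> F' p = 0" if p: "p \<in> M" for p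
  proof -
    obtain c where c: "c \<in> A" "p \<in> chart_dom c"
      using chart_cover[OF p] by blast
    then obtain U where U: "open U" "chart_map c p \<in> U"
      "\<forall>y\<in>U. \<forall>i. F' i (chart_inv c y) = F' i (chart_inv c (chart_map c p))"
      using local[of c "chart_map c p"] by blast
    have "det (jacobian c F' (chart_map c p)) = 0"
      by (rule jacobian_det_eq_0[OF U(1,2), of F' e]) (use U(3) in blast)
    then show ?thesis
      using bracket_eq_0_iff[of F' c p] smooth c by simp
  qed
  then show ?thesis
    using smooth close by blast
qed

lemma perturbation_dim_ge_2:
  assumes "compact M" and F: "\<forall>i. F i \<in> smooth_functions A" and dim: "CARD('n) \<ge> 2" and r: "r > 0"
    and L1: "L1_norm M A \<Omega> (bracket A \<Omega> F) \<le> 2 * r ^ CARD('n)"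
  shows "\<exists>F'. (\<forall>i. F' i \<in> smooth_functions A) \<and> (\<forall>i. \<forall>p\<in>M. \<bar>F i p - F' i p\<bar> \<le> r) \<and>
    (\<forall>p\<in>M. bracket A \<Omega> F' p = 0)"
proof -
  let ?f = "\<lambda>p. \<chi> i. F i p"
  \<comment> \<open>Since \<open>n \<ge> 2\<close>, a cell of side \<open>\<delta>\<close> has volume more than \<open>2 r\<^sup>n\<close>, although points move by at most
    \<open>\<delta> (1 / 2 + s) \<le> r\<close>; no such \<open>\<delta>\<close> exists for \<open>n = 1\<close>.\<close>
  define \<delta> where "\<delta> = 3 / 2 * r"
  have \<delta>: "\<delta> > 0"
    using r by (simp add: \<delta>_def)
  have "(2 :: real) < (3 / 2) ^ 2"
    by (simp add: power2_eq_square)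
  also have "\<dots> \<le> (3 / 2) ^ CARD('n)"
    using dim by (intro power_increasing) auto
  finally have "2 * r ^ CARD('n) < (3 / 2) ^ CARD('n) * r ^ CARD('n)"
    using r by (intro mult_strict_right_mono) auto
  then have "2 * r ^ CARD('n) < \<delta> ^ CARD('n)"
    by (simp only: \<delta>_def power_mult_distrib)
  then have small: "measure lebesgue (?f ` M) < \<delta> ^ CARD('n)"
    using measure_image_le_L1_norm(2)[OF assms(1) F] L1 by linarith
  have compact: "compact (?f ` M)"
    by (intro compact_continuous_image continuous_on_vec_lambda smooth_function_continuous[OF F[rule_format]] assms(1))
  obtain t where "\<And>k :: 'n \<Rightarrow> int. t + (\<chi> i. \<delta> * k i) \<notin> ?f ` M"
    using lattice_translate_avoids[OF compact_imp_bounded[OF compact] measure_image_le_L1_norm(1)[OF assms(1) F] \<delta> small]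
    by blast
  then obtain s0 where s0: "s0 > 0"
      "\<forall>y\<in>?f ` M. \<exists>i. s0 < \<bar>(y $ i - t $ i) / \<delta> - round ((y $ i - t $ i) / \<delta>)\<bar>"
    using lattice_distance[OF compact \<delta>] by blast
  \<comment> \<open>The bound 1/6 makes \<delta>(1/2 + s) at most (3r/2)(2/3) = r; the bound
    \<open>s0\<close> keeps the good coordinates good.\<close>
  define s where "s = min s0 (1 / 6)"
  have s: "0 < s" "s < 1 / 2" "s \<le> 1 / 6" "s \<le> s0"
    using s0(1) by (auto simp: s_def)
  \<comment> \<open>The staircase rescaled to mesh \<delta> and shifted by \<open>t\<close>: it
    varies only within \<delta> s of the translated multiples of \<delta>.\<close>
  define \<tau> where "\<tau> i x = t $ i + \<delta> * stair s ((x - t $ i) / \<delta>)" for i x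
  have smooth_\<tau>: "smooth_on UNIV (\<tau> i)" for i
  proof -
    have "smooth_on UNIV (\<lambda>x. (x - t $ i) / \<delta>)"
      using \<delta> by (intro smooth_on_divide smooth_on_diff smooth_on_id smooth_on_const) auto
    then have "smooth_on UNIV (\<lambda>x. stair s ((x - t $ i) / \<delta>))"
      by (rule smooth_on_compose[OF open_UNIV open_UNIV _ _ smooth_on_stair[OF s(1,2)], rotated]) simp
    then have "smooth_on UNIV (\<lambda>x. \<delta> * stair s ((x - t $ i) / \<delta>))"
      by (intro smooth_on_mult smooth_on_const) auto
    then show ?thesis
      unfolding \<tau>_def by (intro smooth_on_add smooth_on_const) auto
  qed
  define F' where "F' i p = \<tau> i (F i p)" for i p
  have smooth: "\<forall>i. F' i \<in> smooth_functions A"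
    unfolding smooth_functions_def mem_Collect_eq
  proof (intro allI ballI)
    fix i c assume c: "c \<in> A"
    have "smooth_on (chart_codom c) (\<lambda>x. \<tau> i ((F i \<circ> chart_inv c) x))"
      by (rule smooth_on_compose[OF open_chart_codom[OF c] open_UNIV _ smooth_functionsD[OF F[rule_format] c] smooth_\<tau>]) simp
    then show "smooth_on (chart_codom c) (F' i \<circ> chart_inv c)"
      by (simp add: F'_def o_def)
  qed
  have close: "\<bar>F i p - F' i p\<bar> \<le> r" for i p
  proof -
    let ?u = "(F i p - t $ i) / \<delta>"
    have "F i p - F' i p = \<delta> * (?u - stair s ?u)"
      using \<delta> by (simp add: F'_def \<tau>_def field_simps)
    then have "\<bar>F i p - F' i p\<bar> = \<delta> * \<bar>stair s ?u - ?u\<bar>"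
      using \<delta> by (simp add: abs_mult abs_minus_commute)
    also have "\<dots> \<le> \<delta> * (1 / 2 + 1 / 6)"
      using stair_dist[OF s(1), of ?u] s(3) \<delta> by (intro mult_left_mono) auto
    also have "\<dots> = r"
      by (simp add: \<delta>_def)
    finally show ?thesis .
  qed
  have "bracket A \<Omega> F' p = 0" if p: "p \<in> M" for p
  proof -
    \<comment> \<open>This coordinate of \<open>p\<close> avoids the jumps; continuity of
      \<open>F i\<close> spreads the constancy of the staircase to a neighbourhood of
      \<open>p\<close> in \<open>M\<close>.\<close>
    obtain i where "s0 < \<bar>(F i p - t $ i) / \<delta> - round ((F i p - t $ i) / \<delta>)\<bar>"
      using s0(2) p by auto
    then obtain U where U: "open U" "(F i p - t $ i) / \<delta> \<in> U"
      "\<forall>y\<in>U. stair s y = stair s ((F i p - t $ i) / \<delta>)"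
      using stair_locally_constant[OF s(1,2), of "(F i p - t $ i) / \<delta>"] s(4) by auto
    let ?V = "M \<inter> (\<lambda>q. (F i q - t $ i) / \<delta>) -` U"
    have "continuous_on M (\<lambda>q. (F i q - t $ i) / \<delta>)"
      using smooth_function_continuous[OF F[rule_format]] \<delta> by (intro continuous_intros) auto
    then have "openin (top_of_set M) ?V"
      using U(1) by (simp add: continuous_openin_preimage_eq)
    then show ?thesis
    proof (rule bracket_eq_0_locally_constant[OF smooth p])
      show "p \<in> ?V"
        using p U(2) by simp
      show "F' i q = F' i p" if "q \<in> ?V" for q
        using U(3) that by (simp add: F'_def \<tau>_def)
    qed
  qed
  then show ?thesis
    using smooth close by blast
qed

end

theorem theorem1p3:
  fixes M :: "'a::t2_space set"
    and A :: "('a, 'n::finite) chart set"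
    and \<Omega> :: "('a, 'n) top_form"
    and \<epsilon> :: real
    and F :: "'n \<Rightarrow> 'a \<Rightarrow> real"
  assumes "closed_manifold M A"
    and "volume_form M A \<Omega>"
    and "\<epsilon> \<ge> 0"
    and "\<forall>i. F i \<in> smooth_functions A"
    and "L1_norm M A \<Omega> (bracket A \<Omega> F) \<le> 2 * \<epsilon>"
  shows "\<exists>F' :: 'n \<Rightarrow> 'a \<Rightarrow> real.
    (\<forall>i. F' i \<in> smooth_functions A) \<and>
    (\<forall>i. uniform_norm M (\<lambda>p. F i p - F' i p) \<le> ennreal (root CARD('n) \<epsilon>)) \<and>
    (\<forall>p\<in>M. bracket A \<Omega> F' p = 0)"
proof -
  interpret smooth_volume M A \<Omega>
    using assms(1,2) by unfold_locales (auto simp: closed_manifold_def smooth_manifold_def)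
  have "compact M"
    using assms(1) by (simp add: closed_manifold_def)
  define r where "r = root CARD('n) \<epsilon>"
  have r: "r \<ge> 0" "r ^ CARD('n) = \<epsilon>"
    using assms(3) by (simp_all add: r_def)
  have "\<exists>F'. (\<forall>i. F' i \<in> smooth_functions A) \<and> (\<forall>i. \<forall>p\<in>M. \<bar>F i p - F' i p\<bar> \<le> r) \<and>
    (\<forall>p\<in>M. bracket A \<Omega> F' p = 0)"
  \<comment> \<open>For \<epsilon> = 0 the mesh 3r/2 would degenerate to 0; there \<open>F\<close>
    itself serves as \<open>F'\<close>.\<close>
  proof (cases "\<epsilon> = 0")
    case True
    then have "\<forall>p\<in>M. bracket A \<Omega> F p = 0"
      using L1_norm_bracket_le_0[OF \<open>compact M\<close> assms(4)] assms(5) by simp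
    then show ?thesis
      using assms(4) r(1) by (intro exI[of _ F]) simp
  next
    case False
    then have "r > 0"
      using assms(3) by (simp add: r_def)
    show ?thesis
    proof (cases "CARD('n) = 1")
      case True
      then show ?thesis
        using perturbation_dim_1[OF \<open>compact M\<close> assms(4) True assms(5)] r(2) by simp
    next
      case False
      moreover have "CARD('n) > 0"
        by simp
      ultimately have "CARD('n) \<ge> 2"
        by linarith
      then show ?thesis
        using perturbation_dim_ge_2[OF \<open>compact M\<close> assms(4) _ \<open>r > 0\<close>] assms(5) r(2) by simp
    qed
  qed
  then obtain F' where F': "\<forall>i. F' i \<in> smooth_functions A" "\<And>i p. p \<in> M \<Longrightarrow> \<bar>F i p - F' i p\<bar> \<le> r"
    "\<forall>p\<in>M. bracket A \<Omega> F' p = 0"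
    by blast
  have "uniform_norm M (\<lambda>p. F i p - F' i p) \<le> ennreal r" for i
    unfolding uniform_norm_def by (intro SUP_least ennreal_leI F'(2))
  then show ?thesis
    using F'(1,3) by (auto simp: r_def)
qed

end
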